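(* Let $\Phi\colon\mathbb{R}^n\to\mathbb{R}$ be a convex function for which there are constants $C,\delta\ge0$ such that $|\Phi(\mathbf{x})-\Phi(\mathbf{y})|\le C\|\mathbf{x}-\mathbf{y}\|(1+\|\mathbf{x}\|^\delta+\|\mathbf{y}\|^\delta)$ for all $\mathbf{x},\mathbf{y}\in\mathbb{R}^n$. Let $a_1,\dots,a_n,b_1,\dots,b_n>0$, for each $i$ let $U_i\colon\mathbb{R}\to(-\infty,0]$ be given by $U_i(x)=-a_ix$ for $x\ge0$ and $U_i(x)=b_ix$ for $x<0$, and let $U(\mathbf{x})=\sum_{i=1}^nU_i(x_i)$. Let $\mathbf{x}\in\mathbb{R}^n$ and $t>0$, and let $\mathbf{p}^*=(p_1^*,\dots,p_n^* )$ be the unique maximizer in $$V(\mathbf{x},t)=\sup_{\mathbf{p}\in\mathbb{R}^n}\left\{\sum_{i=1}^nV(x_i,t;p_i,a_i,b_i)-\Phi^*(\mathbf{p})\right\},$$ where $V(x,t;p,a,b)$ is the explicit function given in the context and $\Phi^*$ is the Legendre-Fenchel transform of $\Phi$. Then the unique optimal trajectory of the optimal control problem $$\inf\left\{\int_0^t\left(\frac12\|\dot{\mathbf{x}}(s)\|^2-U(\mathbf{x}(s))\right)ds+\Phi(\mathbf{x}(0))\colon\mathbf{x}(t)=\mathbf{x}\right\},$$ where the infimum is over Lipschitz functions $\mathbf{x}(\cdot)\colon[0,t]\to\mathbb{R}^n$, is $$[0,t]\ni s\mapsto\boldsymbol\gamma(s;\mathbf{x},t):=\left(\gamma(s;x_1,t,p_1^*,a_1,b_1),\dots,\gamma(s;x_n,t,p_n^*,a_n,b_n)\right),$$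 where $\gamma(s;x,t,p,a,b)$ is the explicit trajectory given in the context. Moreover, the optimal value of this problem equals $V(\mathbf{x},t)$.
   Context: Explicit function. For $a,b>0$, $x,p\in\mathbb{R}$, $t\ge0$, define $V(x,t;p,a,b)$ as follows. If $p\ge0$, then $V(x,t;p,a,b)=f_i(x,t;p,a,b)$ whenever $(x,t,p)\in\Omega_i$, $i=1,\dots,5$, where (the regions depend on $a,b$, are subsets of $\mathbb{R}\times[0,+\infty)\times[0,+\infty)$, and partition it) $\Omega_1=\{x\ge pt+\frac a2t^2\}$; $\Omega_2=\{x<0,\ t<\frac pb\}\cup\{x<-\frac b2(t-\frac pb)^2,\ t\ge\frac pb\}$; $\Omega_3=\{0\le x<pt+\frac a2t^2,\ t<\frac pb\}\cup\{\frac a2(t-\frac pb)^2\le x<pt+\frac a2t^2,\ t\ge\frac pb\}$; $\Omega_4=\{0\le x<\frac a2(t-\frac pb)^2,\ t\ge\frac pb\}$; $\Omega_5=\{-\frac b2(t-\frac pb)^2\le x<0,\ t\ge\frac pb\}$; and $f_1=-\frac{a^2}{6}t^3-\frac a2pt^2+atx-\frac12p^2t+px$; $f_2=-\frac{b^2}{6}t^3+\frac b2pt^2-\frac12p^2t+px-btx$; $f_3=\frac{a+b}{3(a+2b)^2}\left((bt-p)^3+((bt-p)^2+2x(a+2b))^{3/2}\right)-\frac{b}{a+2b}(bt-p)x-\frac{b^2}{6}t^3+\frac b2pt^2-\frac12p^2t$; $f_4=\frac{a^2}{3}\left(\frac{2x}{a}\right)^{3/2}-\frac{p^3}{6b}$;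 $f_5=\frac{b^2}{3}\left(\frac{-2x}{b}\right)^{3/2}-\frac{p^3}{6b}$. If $p<0$, then $V(x,t;p,a,b)=V(-x,t;-p,b,a)$ (the right-hand side being given by the case $-p>0$ with $a$ and $b$ exchanged). Explicit trajectory. For $a,b>0$, $x,p\in\mathbb{R}$, $t>0$, $s\in[0,t]$, define $\gamma(s;x,t,p,a,b)$ as follows. If $p\ge0$: - $(x,t,p)\in\Omega_1$: $\gamma=x-p(t-s)-\frac a2(t^2-s^2)$. - $(x,t,p)\in\Omega_2$: $\gamma=x-p(t-s)+\frac b2(t^2-s^2)$. - $(x,t,p)\in\Omega_3$: with $\tau=\frac{(a+b)t+p-\sqrt{(bt-p)^2+2(2b+a)x}}{2b+a}\in[0,t]$, $\gamma=-p(\tau-s)+\frac b2(\tau^2-s^2)$ for $s\in[0,\tau)$ and $\gamma=(p-b\tau)(s-\tau)+\frac a2(s-\tau)^2$ for $s\in[\tau,t]$. - $(x,t,p)\in\Omega_4$: $\gamma=-\frac1{2b}(p-bs)^2$ for $s\in[0,\frac pb)$; $\gamma=0$ for $s\in[\frac pb,t-\sqrt{2x/a})$; $\gamma=\frac a2\left(s-t+\sqrt{2x/a}\right)^2$ for $s\in[t-\sqrt{2x/a},t]$. - $(x,t,p)\in\Omega_5$: $\gamma=-\frac1{2b}(p-bs)^2$ for $s\in[0,\frac pb)$; $\gamma=0$ for $s\in[\frac pb,t-\sqrt{2|x|/b})$; $\gamma=-\frac b2\left(s-t+\sqrt{2|x|/b}\right)^2$ for $s\in[t-\sqrt{2|x|/b},t]$.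 If $p<0$: $\gamma(s;x,t,p,a,b)=-\gamma(s;-x,t,-p,b,a)$. Other notation. $\Phi^*(\mathbf{p})=\sup_{\mathbf{x}}\{\langle\mathbf{p},\mathbf{x}\rangle-\Phi(\mathbf{x})\}\in\mathbb{R}\cup\{+\infty\}$; $\|\cdot\|$ is the Euclidean norm. For $t>0$ the maximizer $\mathbf{p}^*$ exists and is unique. An optimal trajectory is an admissible trajectory attaining the infimum. *)

theory Defs
  imports "HOL-Analysis.Analysis"
begin

text \<open>Points of the regions are triples \<open>(x, t, p)\<close>.  For \<open>a, b > 0\<close> the five regions partition
  \<open>{(x, t, p). t \<ge> 0 \<and> p \<ge> 0}\<close>,
  so the order of the nested conditionals in the definitions by cases below is immaterial.\<close>

definition Omega1 :: "real \<Rightarrow> real \<Rightarrow> (real \<times> real \<times> real) set" where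
  "Omega1 a b = {(x, t, p). t \<ge> 0 \<and> p \<ge> 0 \<and> x \<ge> p * t + a / 2 * t\<^sup>2}"

definition Omega2 :: "real \<Rightarrow> real \<Rightarrow> (real \<times> real \<times> real) set" where
  "Omega2 a b = {(x, t, p). t \<ge> 0 \<and> p \<ge> 0 \<and>
     (x < 0 \<and> t < p / b \<or> x < - (b / 2) * (t - p / b)\<^sup>2 \<and> t \<ge> p / b)}"

definition Omega3 :: "real \<Rightarrow> real \<Rightarrow> (real \<times> real \<times> real) set" where
  "Omega3 a b = {(x, t, p). t \<ge> 0 \<and> p \<ge> 0 \<and>
     (0 \<le> x \<and> x < p * t + a / 2 * t\<^sup>2 \<and> t < p / b \<or>
      a / 2 * (t - p / b)\<^sup>2 \<le> x \<and> x < p * t + a / 2 * t\<^sup>2 \<and> t \<ge> p / b)}"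

definition Omega4 :: "real \<Rightarrow> real \<Rightarrow> (real \<times> real \<times> real) set" where
  "Omega4 a b = {(x, t, p). t \<ge> 0 \<and> p \<ge> 0 \<and>
     0 \<le> x \<and> x < a / 2 * (t - p / b)\<^sup>2 \<and> t \<ge> p / b}"

definition Omega5 :: "real \<Rightarrow> real \<Rightarrow> (real \<times> real \<times> real) set" where
  "Omega5 a b = {(x, t, p). t \<ge> 0 \<and> p \<ge> 0 \<and>
     - (b / 2) * (t - p / b)\<^sup>2 \<le> x \<and> x < 0 \<and> t \<ge> p / b}"

definition f1 :: "real \<Rightarrow> real \<Rightarrow> real \<Rightarrow> real \<Rightarrow> real \<Rightarrow> real" where
  "f1 x t p a b =
     - (a\<^sup>2 / 6) * t ^ 3 - a / 2 * p * t\<^sup>2 + a * t * x - 1 / 2 * p\<^sup>2 * t + p * x"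

definition f2 :: "real \<Rightarrow> real \<Rightarrow> real \<Rightarrow> real \<Rightarrow> real \<Rightarrow> real" where
  "f2 x t p a b =
     - (b\<^sup>2 / 6) * t ^ 3 + b / 2 * p * t\<^sup>2 - 1 / 2 * p\<^sup>2 * t + p * x - b * t * x"

definition f3 :: "real \<Rightarrow> real \<Rightarrow> real \<Rightarrow> real \<Rightarrow> real \<Rightarrow> real" where
  "f3 x t p a b =
     (a + b) / (3 * (a + 2 * b)\<^sup>2) *
       ((b * t - p) ^ 3 + ((b * t - p)\<^sup>2 + 2 * x * (a + 2 * b)) powr (3 / 2))
     - b / (a + 2 * b) * (b * t - p) * x
     - b\<^sup>2 / 6 * t ^ 3 + b / 2 * p * t\<^sup>2 - 1 / 2 * p\<^sup>2 * t"

definition f4 :: "real \<Rightarrow> real \<Rightarrow> real \<Rightarrow> real \<Rightarrow> real \<Rightarrow> real" where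
  "f4 x t p a b = a\<^sup>2 / 3 * (2 * x / a) powr (3 / 2) - p ^ 3 / (6 * b)"

definition f5 :: "real \<Rightarrow> real \<Rightarrow> real \<Rightarrow> real \<Rightarrow> real \<Rightarrow> real" where
  "f5 x t p a b = b\<^sup>2 / 3 * (- 2 * x / b) powr (3 / 2) - p ^ 3 / (6 * b)"

definition V_nonneg :: "real \<Rightarrow> real \<Rightarrow> real \<Rightarrow> real \<Rightarrow> real \<Rightarrow> real" where
  "V_nonneg x t p a b =
     (if (x, t, p) \<in> Omega1 a b then f1 x t p a b
      else if (x, t, p) \<in> Omega2 a b then f2 x t p a b
      else if (x, t, p) \<in> Omega3 a b then f3 x t p a b
      else if (x, t, p) \<in> Omega4 a b then f4 x t p a b
      else f5 x t p a b)"

definition V_expl :: "real \<Rightarrow> real \<Rightarrow> real \<Rightarrow> real \<Rightarrow> real \<Rightarrow> real" where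
  "V_expl x t p a b = (if p \<ge> 0 then V_nonneg x t p a b else V_nonneg (- x) t (- p) b a)"

definition tau3 :: "real \<Rightarrow> real \<Rightarrow> real \<Rightarrow> real \<Rightarrow> real \<Rightarrow> real" where
  "tau3 x t p a b =
     ((a + b) * t + p - sqrt ((b * t - p)\<^sup>2 + 2 * (2 * b + a) * x)) / (2 * b + a)"

definition gamma1 :: "real \<Rightarrow> real \<Rightarrow> real \<Rightarrow> real \<Rightarrow> real \<Rightarrow> real \<Rightarrow> real" where
  "gamma1 s x t p a b = x - p * (t - s) - a / 2 * (t\<^sup>2 - s\<^sup>2)"

definition gamma2 :: "real \<Rightarrow> real \<Rightarrow> real \<Rightarrow> real \<Rightarrow> real \<Rightarrow> real \<Rightarrow> real" where
  "gamma2 s x t p a b = x - p * (t - s) + b / 2 * (t\<^sup>2 - s\<^sup>2)"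

definition gamma3 :: "real \<Rightarrow> real \<Rightarrow> real \<Rightarrow> real \<Rightarrow> real \<Rightarrow> real \<Rightarrow> real" where
  "gamma3 s x t p a b =
     (let \<tau> = tau3 x t p a b in
      if s < \<tau> then - p * (\<tau> - s) + b / 2 * (\<tau>\<^sup>2 - s\<^sup>2)
      else (p - b * \<tau>) * (s - \<tau>) + a / 2 * (s - \<tau>)\<^sup>2)"

definition gamma4 :: "real \<Rightarrow> real \<Rightarrow> real \<Rightarrow> real \<Rightarrow> real \<Rightarrow> real \<Rightarrow> real" where
  "gamma4 s x t p a b =
     (if s < p / b then - (1 / (2 * b)) * (p - b * s)\<^sup>2
      else if s < t - sqrt (2 * x / a) then 0
      else a / 2 * (s - t + sqrt (2 * x / a))\<^sup>2)"

definition gamma5 :: "real \<Rightarrow> real \<Rightarrow> real \<Rightarrow> real \<Rightarrow> real \<Rightarrow> real \<Rightarrow> real" where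
  "gamma5 s x t p a b =
     (if s < p / b then - (1 / (2 * b)) * (p - b * s)\<^sup>2
      else if s < t - sqrt (2 * \<bar>x\<bar> / b) then 0
      else - (b / 2) * (s - t + sqrt (2 * \<bar>x\<bar> / b))\<^sup>2)"

definition gamma_nonneg :: "real \<Rightarrow> real \<Rightarrow> real \<Rightarrow> real \<Rightarrow> real \<Rightarrow> real \<Rightarrow> real" where
  "gamma_nonneg s x t p a b =
     (if (x, t, p) \<in> Omega1 a b then gamma1 s x t p a b
      else if (x, t, p) \<in> Omega2 a b then gamma2 s x t p a b
      else if (x, t, p) \<in> Omega3 a b then gamma3 s x t p a b
      else if (x, t, p) \<in> Omega4 a b then gamma4 s x t p a b
      else gamma5 s x t p a b)"

definition gamma_expl :: "real \<Rightarrow> real \<Rightarrow> real \<Rightarrow> real \<Rightarrow> real \<Rightarrow> real \<Rightarrow> real" where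
  "gamma_expl s x t p a b =
     (if p \<ge> 0 then gamma_nonneg s x t p a b else - gamma_nonneg s (- x) t (- p) b a)"

definition legendre :: "('v::real_inner \<Rightarrow> real) \<Rightarrow> 'v \<Rightarrow> ereal" where
  "legendre \<Phi> p = (SUP x. ereal (inner p x - \<Phi> x))"

definition hopf_objective ::
    "(real^'n \<Rightarrow> real) \<Rightarrow> real^'n \<Rightarrow> real^'n \<Rightarrow> real^'n \<Rightarrow> real \<Rightarrow> real^'n \<Rightarrow> ereal" where
  "hopf_objective \<Phi> a b x t p =
     ereal (\<Sum>i\<in>UNIV. V_expl (x$i) t (p$i) (a$i) (b$i)) - legendre \<Phi> p"

definition V_hopf ::
    "(real^'n \<Rightarrow> real) \<Rightarrow> real^'n \<Rightarrow> real^'n \<Rightarrow> real^'n \<Rightarrow> real \<Rightarrow> ereal" where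
  "V_hopf \<Phi> a b x t = (SUP p. hopf_objective \<Phi> a b x t p)"

definition gamma_vec ::
    "real^'n \<Rightarrow> real^'n \<Rightarrow> real^'n \<Rightarrow> real \<Rightarrow> real^'n \<Rightarrow> real \<Rightarrow> real^'n" where
  "gamma_vec a b x t p s = (\<chi> i. gamma_expl s (x$i) t (p$i) (a$i) (b$i))"

definition potential1 :: "real \<Rightarrow> real \<Rightarrow> real \<Rightarrow> real" where
  "potential1 a b x = (if x \<ge> 0 then - a * x else b * x)"

definition potential :: "real^'n \<Rightarrow> real^'n \<Rightarrow> real^'n \<Rightarrow> real" where
  "potential a b x = (\<Sum>i\<in>UNIV. potential1 (a$i) (b$i) (x$i))"

definition admissible :: "real^'n \<Rightarrow> real \<Rightarrow> (real \<Rightarrow> real^'n) \<Rightarrow> bool" where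
  "admissible x t y \<longleftrightarrow> (\<exists>L. L-lipschitz_on {0..t} y) \<and> y t = x"

text \<open>A Lipschitz trajectory is differentiable only almost everywhere; at the exceptional points
  \<^const>\<open>vector_derivative\<close> has an unspecified value, which does not affect the integral.\<close>

definition cost ::
    "(real^'n \<Rightarrow> real) \<Rightarrow> real^'n \<Rightarrow> real^'n \<Rightarrow> real \<Rightarrow> (real \<Rightarrow> real^'n) \<Rightarrow> real" where
  "cost \<Phi> a b t y =
     integral {0..t} (\<lambda>s. 1 / 2 * (norm (vector_derivative y (at s within {0..t})))\<^sup>2
                          - potential a b (y s))
     + \<Phi> (y 0)"

definition optimal_value ::
    "(real^'n \<Rightarrow> real) \<Rightarrow> real^'n \<Rightarrow> real^'n \<Rightarrow> real^'n \<Rightarrow> real \<Rightarrow> ereal" where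
  "optimal_value \<Phi> a b x t = (INF y\<in>{y. admissible x t y}. ereal (cost \<Phi> a b t y))"

definition optimal_trajectory ::
    "(real^'n \<Rightarrow> real) \<Rightarrow> real^'n \<Rightarrow> real^'n \<Rightarrow> real^'n \<Rightarrow> real \<Rightarrow> (real \<Rightarrow> real^'n) \<Rightarrow> bool" where
  "optimal_trajectory \<Phi> a b x t y \<longleftrightarrow>
     admissible x t y \<and> ereal (cost \<Phi> a b t y) = optimal_value \<Phi> a b x t"

end

theory Submission
  imports Defs
begin

text \<open>For a linear initial cost \<open>p * y 0\<close> the problem splits into scalar convex problems. Along the explicit
  trajectory the velocity \<open>m\<close> satisfies \<open>m 0 = p\<close> and \<open>m' = \<xi>\<close> with \<open>\<xi>\<close> a subgradient of minus the potential, so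
  completing the square in \<open>v - m\<close> shows that the explicit function is the optimal value and that every
  competitor \<open>y\<close> pays an excess of at least \<open>(y s - g s)\<^sup>2 / (2 * t)\<close> at each time \<open>s\<close>. This excess makes the explicit
  function, as a function of \<open>p\<close>, concave with Lipschitz gradient \<open>\<gamma> 0\<close>. The dual problem therefore has a
  maximizer \<open>p\<close>, where \<open>\<gamma> 0\<close> lies in the subdifferential of the Legendre transform; equality in
  the Fenchel-Young inequality then turns the excess estimate for the linear initial cost into one for \<open>\<Phi>\<close>.\<close>

section \<open>Lipschitz functions of a real variable\<close>

text \<open>The cost reads the velocity of an arbitrary Lipschitz trajectory, so completing the
  square in \<open>v - m\<close> requires that such a trajectory be differentiable almost everywhere
  and that its derivative integrate back to the increments. The measure-theoretic start supplies
  both facts on the line. The constant \<open>1 / (2 * t)\<close> is Cauchy-Schwarz for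
  \<open>y - g\<close>, which vanishes at time \<open>t\<close>: its square at any time is at most
  \<open>t\<close> times the integral of \<open>(v - m)\<^sup>2\<close>, and half of that integral
  is the excess. The explicit function is never differentiated in \<open>p\<close>. Taking the
  extremal of one \<open>p\<close> as a competitor in the problem of another \<open>q\<close>
  already gives the supergradient inequality with its quadratic remainder, so smoothness across the
  region boundaries is never at issue. The formulas are used only to check the Pontryagin conditions
  region by region. Uniqueness of the maximizer is read off the trajectories: two maximizers share
  the optimal trajectory, and its initial velocity is the maximizer itself.\<close>

lemma emeasure_interval_measure_box:
  fixes F :: "real \<Rightarrow> real"
  assumes "l \<le> u" and mono: "\<And>x y. x \<le> y \<Longrightarrow> F x \<le> F y" and cont: "continuous_on UNIV F"
  shows "emeasure (interval_measure F) {l<..<u} = ennreal (F u - F l)"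
proof (cases "l = u")
  case False
  have rc: "continuous (at_right c) F" for c
    using cont by (simp add: continuous_on_eq_continuous_within continuous_at_imp_continuous_at_within)
  have "emeasure (interval_measure F) {u..u} = 0"
    by (subst emeasure_interval_measure_Icc[OF order_refl mono cont]) auto
  then have "emeasure (interval_measure F) ({l<..u} - {u}) = emeasure (interval_measure F) {l<..u}"
    by (intro emeasure_Diff_null_set) (auto simp: null_sets_def)
  moreover have "{l<..u} - {u} = {l<..<u}"
    using False assms(1) by auto
  ultimately show ?thesis
    by (simp add: emeasure_interval_measure_Ioc[OF assms(1) mono rc])
qed auto

lemma continuous_on_mono_nonexpansive:
  fixes F :: "real \<Rightarrow> real"
  assumes mono: "\<And>x y. x \<le> y \<Longrightarrow> F x \<le> F y" and lip: "\<And>x y. x \<le> y \<Longrightarrow> F y - F x \<le> y - x"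
  shows "continuous_on UNIV F"
proof -
  have "1-lipschitz_on UNIV F"
  proof (rule lipschitz_onI)
    fix x y :: real
    show "dist (F x) (F y) \<le> 1 * dist x y"
      using lip[of x y] lip[of y x] mono[of x y] mono[of y x]
      by (cases "x \<le> y") (auto simp: dist_real_def)
  qed simp
  then show ?thesis
    by (rule lipschitz_on_continuous_on)
qed

text \<open>The complementary function \<open>x - F x\<close> is monotone too, and the two Stieltjes
  measures add up to Lebesgue measure, since on an open interval the increments sum to its length.
  Each summand is then dominated by the total.\<close>

lemma emeasure_interval_measure_le_lborel:
  fixes F :: "real \<Rightarrow> real"
  assumes mono: "\<And>x y. x \<le> y \<Longrightarrow> F x \<le> F y" and lip: "\<And>x y. x \<le> y \<Longrightarrow> F y - F x \<le> y - x"
    and A: "A \<in> sets borel"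
  shows "emeasure (interval_measure F) A \<le> emeasure lborel A"
proof -
  define G where "G = (\<lambda>x. x - F x)"
  have monoG: "\<And>x y. x \<le> y \<Longrightarrow> G x \<le> G y"
    using lip by (fastforce simp: G_def)
  have contF: "continuous_on UNIV F"
    using mono lip by (rule continuous_on_mono_nonexpansive)
  then have contG: "continuous_on UNIV G"
    unfolding G_def by (intro continuous_intros)
  let ?s = "\<lambda>A. emeasure (interval_measure F) A + emeasure (interval_measure G) A"
  define M where "M = measure_of UNIV (sets borel) ?s"
  have sM: "sets M = sets borel" unfolding M_def
    by (metis sets.sigma_sets_eq sets_measure_of sets.space_closed space_borel)
  have eM: "emeasure M A = ?s A" if "A \<in> sets borel" for A
  proof (rule emeasure_measure_of[OF M_def])
    show "sets borel \<subseteq> Pow (UNIV::real set)" by simp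
    show "positive (sets M) ?s" by (simp add: positive_def)
    show "A \<in> sets M" using that sM by simp
    show "countably_additive (sets M) ?s"
    proof (rule countably_additiveI)
      fix B :: "nat \<Rightarrow> real set"
      assume B: "range B \<subseteq> sets M" "disjoint_family B"
      show "(\<Sum>i. ?s (B i)) = ?s (\<Union>i. B i)"
        using B sM by (subst suminf_add[symmetric]) (auto simp: suminf_emeasure)
    qed
  qed
  have "lborel = M"
  proof (rule lborel_eqI)
    show "sets M = sets borel" by (rule sM)
    fix l u :: real assume *: "\<And>b. b \<in> Basis \<Longrightarrow> l \<bullet> b \<le> u \<bullet> b"
    then have "l \<le> u" by simp
    then show "emeasure M (box l u) = ennreal (\<Prod>b\<in>Basis. (u - l) \<bullet> b)"
      using mono[of l u] monoG[of l u]
      by (simp add: box_real eM emeasure_interval_measure_box[OF _ mono contF]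
            emeasure_interval_measure_box[OF _ monoG contG] ennreal_plus[symmetric] del: ennreal_plus)
        (simp add: G_def)
  qed
  then show ?thesis using eM[OF A] by simp
qed

text \<open>The comparison principle behind differentiation of measures: only small intervals, selected
  disjointly by Vitali's theorem, have to be compared.\<close>

lemma Vitali_emeasure_le:
  fixes \<alpha> \<beta> :: "real measure" and E :: "real set" and M :: real
  assumes s\<alpha>: "sets \<alpha> = sets borel" and s\<beta>: "sets \<beta> = sets borel" and E: "E \<in> sets borel"
    and null: "\<And>A. A \<in> null_sets lborel \<Longrightarrow> emeasure \<alpha> A = 0"
    and M: "M > 0" "\<And>A. A \<in> sets borel \<Longrightarrow> emeasure \<beta> A \<le> ennreal M * emeasure lborel A"
    and small: "\<And>x d. x \<in> E \<Longrightarrow> 0 < d \<Longrightarrow> \<exists>u v. u < v \<and> u \<le> x \<and> x \<le> v \<and> v - u < d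
       \<and> emeasure \<alpha> {u..v} \<le> emeasure \<beta> {u..v}"
  shows "emeasure \<alpha> E \<le> emeasure \<beta> E"
proof -
  have open_bound: "emeasure \<alpha> E \<le> emeasure \<beta> U" if U: "open U" "E \<subseteq> U" for U
  proof -
    let ?c = "\<lambda>i::real\<times>real. (fst i + snd i) / 2" and ?r = "\<lambda>i::real\<times>real. (snd i - fst i) / 2"
    have cb: "cball (?c i) (?r i) = {fst i..snd i}" for i
      by (simp add: cball_eq_atLeastAtMost field_simps)
    \<comment> \<open>Intervals are indexed by their endpoints and read as balls for the covering
      theorem. Containment in \<open>U\<close> bounds the mass of the disjoint union by
      \<open>emeasure \<beta> U\<close>.\<close>
    let ?K = "{i. fst i < snd i \<and> {fst i..snd i} \<subseteq> U \<and> emeasure \<alpha> {fst i..snd i} \<le> emeasure \<beta> {fst i..snd i}}"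
    have 1: "0 < ?r i" if "i \<in> ?K" for i using that by simp
    have 2: "\<exists>i. i \<in> ?K \<and> x \<in> cball (?c i) (?r i) \<and> ?r i < d" if x: "x \<in> E" "0 < d" for x d
    proof -
      obtain e where e: "e > 0" "ball x e \<subseteq> U"
        using U x by (meson open_contains_ball subsetD)
      obtain u v where uv: "u < v" "u \<le> x" "x \<le> v" "v - u < min d e" "emeasure \<alpha> {u..v} \<le> emeasure \<beta> {u..v}"
        using small[OF x(1), of "min d e"] x e by auto
      have "{u..v} \<subseteq> ball x e" using uv by (auto simp: dist_real_def)
      then show ?thesis using e uv
        by (intro exI[of _ "(u,v)"]) (auto simp: cb[of "(u,v)", simplified])
    qed
    obtain C where C: "countable C" "C \<subseteq> ?K"
      "pairwise (\<lambda>i j. disjnt (cball (?c i) (?r i)) (cball (?c j) (?r j))) C"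
      "negligible (E - (\<Union>i\<in>C. cball (?c i) (?r i)))"
      using Vitali_covering_theorem_cballs[of ?K ?r E ?c, OF 1 2] by blast
    let ?W = "\<Union>i\<in>C. {fst i..snd i}"
    have disj: "disjoint_family_on (\<lambda>i. {fst i..snd i}) C"
      using C(3) by (simp add: cb disjoint_family_on_def pairwise_def disjnt_def)
    have W: "?W \<in> sets borel" using C(1) by (intro sets.countable_UN') auto
    have "E - ?W \<in> null_sets lborel"
      using C(4) E W unfolding cb
      by (simp add: negligible_iff_null_sets null_sets_completion_iff)
    then have "emeasure \<alpha> (E - ?W) = 0" by (rule null)
    have "emeasure \<alpha> E \<le> emeasure \<alpha> ((E - ?W) \<union> ?W)"
      using E W by (intro emeasure_mono) (auto simp: s\<alpha>)
    also have "\<dots> \<le> emeasure \<alpha> (E - ?W) + emeasure \<alpha> ?W"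
      using E W by (intro emeasure_subadditive) (auto simp: s\<alpha>)
    also have "\<dots> = emeasure \<alpha> ?W" using \<open>emeasure \<alpha> (E - ?W) = 0\<close> by simp
    also have "\<dots> = (\<integral>\<^sup>+i. emeasure \<alpha> {fst i..snd i} \<partial>count_space C)"
      using C(1) disj by (intro emeasure_UN_countable) (auto simp: s\<alpha>)
    also have "\<dots> \<le> (\<integral>\<^sup>+i. emeasure \<beta> {fst i..snd i} \<partial>count_space C)"
      using C(2) by (intro nn_integral_mono) auto
    also have "\<dots> = emeasure \<beta> ?W"
      using C(1) disj by (intro emeasure_UN_countable[symmetric]) (auto simp: s\<beta>)
    also have "\<dots> \<le> emeasure \<beta> U"
      using C(2) U by (intro emeasure_mono) (auto simp: s\<beta>)
    finally show ?thesis .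
  qed
  show ?thesis
  proof (rule ennreal_le_epsilon)
    fix e :: real assume "e > 0"
    \<comment> \<open>The scale \<open>e / M\<close> turns the Lebesgue bound on
      \<open>U - E\<close> into the bound \<open>e\<close> for \<open>\<beta>\<close>.\<close>
    obtain U where U: "open U" "E \<subseteq> U" "emeasure lborel (U - E) < ennreal (e / M)"
      using outer_regular_lborel[OF E, of "e / M"] \<open>e > 0\<close> M(1) by auto
    have "emeasure \<alpha> E \<le> emeasure \<beta> U" by (rule open_bound[OF U(1,2)])
    also have "\<dots> = emeasure \<beta> (E \<union> (U - E))" using U(2) by (simp add: Un_absorb1)
    also have "\<dots> \<le> emeasure \<beta> E + emeasure \<beta> (U - E)"
      using E U by (intro emeasure_subadditive) (auto simp: s\<beta>)
    also have "\<dots> \<le> emeasure \<beta> E + ennreal M * ennreal (e / M)"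
      using E U by (intro add_left_mono order_trans[OF M(2)] mult_left_mono) auto
    also have "ennreal M * ennreal (e / M) = ennreal e"
      using M \<open>e > 0\<close> by (simp add: ennreal_mult[symmetric])
    finally show "emeasure \<alpha> E \<le> emeasure \<beta> E + ennreal e" .
  qed
qed

section \<open>Almost everywhere differentiability of monotone nonexpansive functions\<close>

lemma open_interval_union:
  fixes P :: "real \<Rightarrow> real \<Rightarrow> bool"
  shows "open {x. \<exists>u v. u < x \<and> x < v \<and> P u v}"
proof -
  have "{x. \<exists>u v. u < x \<and> x < v \<and> P u v} = (\<Union>(u,v)\<in>{(u,v). P u v}. {u<..<v})" by auto blast
  then show ?thesis by (auto intro!: open_UN)
qed

text \<open>For \<open>p < q\<close>, a point of \<open>A p \<inter> B q\<close> lies in arbitrarily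
  short intervals of slope below \<open>p\<close> and in others of slope above \<open>q\<close>.
  Comparing the Stieltjes measure of \<open>F\<close> with both multiples of Lebesgue measure forces
  this set to be null. Off the union over rational \<open>p < q\<close>, the slopes over shrinking
  intervals around \<open>x\<close> converge.\<close>

lemma mono_Lipschitz_differentiable_AE:
  fixes F :: "real \<Rightarrow> real"
  assumes mono: "\<And>x y. x \<le> y \<Longrightarrow> F x \<le> F y" and lip: "\<And>x y. x \<le> y \<Longrightarrow> F y - F x \<le> y - x"
  shows "\<exists>N. negligible N \<and> (\<forall>x. x \<notin> N \<longrightarrow> F differentiable (at x))"
proof -
  define lo where "lo = (\<lambda>(p::real) (n::nat). {x. \<exists>u v. u < x \<and> x < v \<and> (v - u < 1 / Suc n \<and> F v - F u < p * (v - u))})"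
  define hi where "hi = (\<lambda>(q::real) (n::nat). {x. \<exists>u v. u < x \<and> x < v \<and> (v - u < 1 / Suc n \<and> F v - F u > q * (v - u))})"
  define A where "A = (\<lambda>p. \<Inter>n. lo p n)"
  define B where "B = (\<lambda>q. \<Inter>n. hi q n)"
  have [measurable]: "A p \<in> sets borel" "B p \<in> sets borel" for p
  proof -
    have "lo p n \<in> sets borel" "hi p n \<in> sets borel" for n
      unfolding lo_def hi_def by (rule borel_open, rule open_interval_union)+
    then show "A p \<in> sets borel" "B p \<in> sets borel"
      unfolding A_def B_def by auto
  qed
  have contF: "continuous_on UNIV F"
    using mono lip by (rule continuous_on_mono_nonexpansive)
  define \<nu> where "\<nu> = interval_measure F"
  have \<nu>: "emeasure \<nu> {u..v} = ennreal (F v - F u)" if "u \<le> v" for u v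
    unfolding \<nu>_def using emeasure_interval_measure_Icc[OF that mono contF] .
  have \<nu>le: "emeasure \<nu> S \<le> emeasure lborel S" if "S \<in> sets borel" for S
    unfolding \<nu>_def using emeasure_interval_measure_le_lborel[OF mono lip that] .
  have [simp, measurable_cong]: "sets \<nu> = sets borel" by (simp add: \<nu>_def)
  have small: "\<exists>n. 1 / Suc n < d" if "d > 0" for d :: real
    using reals_Archimedean[OF that] by (auto simp: inverse_eq_divide)
  have null: "negligible (A p \<inter> B q)" if pq: "0 < p" "p < q" for p q
  proof -
    \<comment> \<open>The cut to a bounded interval makes the Lebesgue measure finite, so that
      \<open>q * r \<le> p * r\<close> yields \<open>r = 0\<close>.\<close>
    have "A p \<inter> B q \<inter> {- real k..real k} \<in> null_sets lborel" for k
    proof -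
      let ?E = "A p \<inter> B q \<inter> {- real k..real k}"
      have E: "?E \<in> sets borel" by measurable
      define sc where "sc = (\<lambda>c. density lborel (\<lambda>_::real. ennreal c))"
      have sc: "emeasure (sc c) S = ennreal c * emeasure lborel S" if "S \<in> sets borel" for c S
        using that unfolding sc_def by (subst emeasure_density_const) auto
      have [simp]: "sets (sc c) = sets borel" for c by (simp add: sc_def)
      have "emeasure \<nu> ?E \<le> emeasure (sc p) ?E"
      proof (rule Vitali_emeasure_le[OF _ _ E, where M = p])
        fix x d :: real assume x: "x \<in> ?E" and "0 < d"
        then obtain n where "1 / Suc n < d" using small by blast
        moreover have "x \<in> lo p n" using x by (auto simp: A_def)
        ultimately obtain u v where uv: "u < x" "x < v" "v - u < d" "F v - F u < p * (v - u)"
          unfolding lo_def by (smt (verit) mem_Collect_eq)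
        then show "\<exists>u v. u < v \<and> u \<le> x \<and> x \<le> v \<and> v - u < d \<and> emeasure \<nu> {u..v} \<le> emeasure (sc p) {u..v}"
          using pq by (intro exI[of _ u] exI[of _ v])
            (auto simp: sc \<nu> ennreal_mult[symmetric] intro!: ennreal_leI)
      next
        fix S :: "real set" assume "S \<in> null_sets lborel"
        then show "emeasure \<nu> S = 0" using \<nu>le[of S] by (auto simp: null_sets_def)
      qed (use pq sc in auto)
      moreover have "emeasure (sc q) ?E \<le> emeasure \<nu> ?E"
      proof (rule Vitali_emeasure_le[OF _ _ E, where M = 1])
        fix x d :: real assume x: "x \<in> ?E" and "0 < d"
        then obtain n where "1 / Suc n < d" using small by blast
        moreover have "x \<in> hi q n" using x by (auto simp: B_def)
        ultimately obtain u v where uv: "u < x" "x < v" "v - u < d" "F v - F u > q * (v - u)"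
          unfolding hi_def by (smt (verit) mem_Collect_eq)
        then show "\<exists>u v. u < v \<and> u \<le> x \<and> x \<le> v \<and> v - u < d \<and> emeasure (sc q) {u..v} \<le> emeasure \<nu> {u..v}"
          using pq by (intro exI[of _ u] exI[of _ v])
            (auto simp: sc \<nu> ennreal_mult[symmetric] intro!: ennreal_leI)
      next
        fix S :: "real set" assume "S \<in> null_sets lborel"
        then show "emeasure (sc q) S = 0" by (subst sc) (auto simp: null_sets_def)
      qed (use \<nu>le in auto)
      ultimately have le: "ennreal q * emeasure lborel ?E \<le> ennreal p * emeasure lborel ?E"
        unfolding sc[OF E] by (rule order.trans[rotated])
      have "emeasure lborel ?E \<le> emeasure lborel {- real k..real k}"
        by (intro emeasure_mono) auto
      also have "\<dots> < \<infinity>" by simp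
      finally obtain r where r: "emeasure lborel ?E = ennreal r" "r \<ge> 0"
        by (cases "emeasure lborel ?E") auto
      then have "q * r \<le> p * r"
        using le pq by (simp add: ennreal_mult[symmetric])
      then have "(q - p) * r \<le> 0" by (simp add: algebra_simps)
      then have "r = 0" using pq r(2) by (simp add: mult_le_0_iff)
      then show ?thesis using E r by (auto simp: null_sets_def)
    qed
    then have "(\<Union>k. A p \<inter> B q \<inter> {- real k..real k}) \<in> null_sets lborel" by blast
    moreover have "(\<Union>k. A p \<inter> B q \<inter> {- real k..real k}) = A p \<inter> B q"
    proof -
      have "\<exists>k. x \<in> {- real k..real k}" for x :: real
        using real_arch_simple[of "\<bar>x\<bar>"] by (auto simp: abs_le_iff) (metis minus_le_iff)
      then show ?thesis by blast
    qed
    ultimately show ?thesis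
      by (simp add: negligible_iff_null_sets null_sets_completionI)
  qed
  define N where "N = (\<Union>(p,q)\<in>{(p,q). p \<in> \<rat> \<and> q \<in> \<rat> \<and> 0 < p \<and> p < q}. A p \<inter> B q)"
  have "countable {(p::real,q::real). p \<in> \<rat> \<and> q \<in> \<rat> \<and> 0 < p \<and> p < q}"
    by (rule countable_subset[of _ "\<rat> \<times> \<rat>"]) (auto intro: countable_rat)
  then have "negligible N" unfolding N_def
    by (intro negligible_countable_Union countable_image) (auto intro: null)
  moreover have "F differentiable (at x)" if "x \<notin> N" for x
  proof -
    define Q where "Q = {c. x \<in> B c}"
    \<comment> \<open>Monotonicity puts every negative slope into \<open>Q\<close>, so that its
      supremum \<open>D\<close> is meaningful and nonnegative.\<close>
    have neg: "c \<in> Q" if "c < 0" for c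
    proof -
      have "x \<in> hi c n" for n
      proof -
        define k where "k = 1 / real (Suc n)"
        let ?h = "k / 3"
        have "k > 0" by (simp add: k_def)
        then have "?h > 0" by simp
        moreover have "(x + ?h) - (x - ?h) < k" using \<open>k > 0\<close> by simp
        moreover have "F (x + ?h) - F (x - ?h) \<ge> 0" using mono[of "x - ?h" "x + ?h"] \<open>k > 0\<close> by simp
        moreover have "c * ((x + ?h) - (x - ?h)) < 0" using that \<open>k > 0\<close> by (intro mult_neg_pos) auto
        ultimately show ?thesis unfolding hi_def k_def[symmetric]
          by (intro CollectI exI[of _ "x - ?h"] exI[of _ "x + ?h"]) linarith
      qed
      then show ?thesis by (simp add: Q_def B_def)
    qed
    have le1: "c \<le> 1" if "c \<in> Q" for c
    proof -
      have "x \<in> hi c 0" using that by (auto simp: Q_def B_def)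
      then obtain u v where "u < x" "x < v" "F v - F u > c * (v - u)" by (auto simp: hi_def)
      then have "0 < (1 - c) * (v - u)" using lip[of u v] by (simp add: algebra_simps)
      then show ?thesis using \<open>u < x\<close> \<open>x < v\<close> by (simp add: zero_less_mult_iff)
    qed
    define D where "D = Sup Q"
    have Q: "Q \<noteq> {}" "bdd_above Q" using neg[of "-1"] le1 by (auto intro: bdd_aboveI[of _ 1])
    have D0: "D \<ge> 0"
    proof (rule field_le_epsilon)
      fix e :: real assume "e > 0"
      then show "0 \<le> D + e" using cSup_upper[OF neg[of "-e"] Q(2)] unfolding D_def by simp
    qed
    have up: "\<exists>d>0. \<forall>u v. u < x \<longrightarrow> x < v \<longrightarrow> v - u < d \<longrightarrow> F v - F u \<le> (D + e) * (v - u)" if "e > 0" for e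
    proof -
      have "D + e \<notin> Q" using cSup_upper[OF _ Q(2), of "D + e"] that unfolding D_def by auto
      then obtain n where "x \<notin> hi (D + e) n" by (auto simp: Q_def B_def)
      then have "F v - F u \<le> (D + e) * (v - u)" if "u < x" "x < v" "v - u < 1 / Suc n" for u v
        using that unfolding hi_def by force
      then show ?thesis by (intro exI[of _ "1 / Suc n"]) auto
    qed
    have dn: "\<exists>d>0. \<forall>u v. u < x \<longrightarrow> x < v \<longrightarrow> v - u < d \<longrightarrow> F v - F u \<ge> (D - e) * (v - u)" if "e > 0" for e
    proof (cases "D - e > 0")
      case True
      \<comment> \<open>Rationals \<open>p < q\<close> are placed strictly between
        \<open>D - e\<close> and \<open>D\<close>. As \<open>q\<close> is below the supremum,
        \<open>x\<close> lies in \<open>B q\<close>, and avoiding \<open>N\<close> keeps it out of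
        \<open>A p\<close>; the case assumption makes \<open>p\<close> positive, as \<open>N\<close>
        demands.\<close>
      obtain p where p: "p \<in> \<rat>" "D - e < p" "p < D" using Rats_dense_in_real[of "D - e" D] \<open>e > 0\<close> by auto
      obtain q where q: "q \<in> \<rat>" "p < q" "q < D" using Rats_dense_in_real[of p D] p by auto
      obtain c where c: "c \<in> Q" "q < c" using less_cSupD[OF Q(1), of q] q unfolding D_def by auto
      have "x \<in> hi q n" for n
      proof -
        have "x \<in> hi c n" using c(1) by (auto simp: Q_def B_def)
        then obtain u v where uv: "u < x" "x < v" "v - u < 1 / Suc n" "F v - F u > c * (v - u)" by (auto simp: hi_def)
        moreover have "q * (v - u) \<le> c * (v - u)" using uv c by (intro mult_right_mono) auto
        ultimately show ?thesis unfolding hi_def by (intro CollectI exI[of _ u] exI[of _ v]) linarith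
      qed
      then have "x \<in> B q" by (simp add: B_def)
      then have "x \<notin> A p" using \<open>x \<notin> N\<close> p q True by (auto simp: N_def)
      then obtain n where n: "x \<notin> lo p n" by (auto simp: A_def)
      show ?thesis
      proof (intro exI[of _ "1 / Suc n"] conjI allI impI)
        fix u v assume uv: "u < x" "x < v" "v - u < 1 / real (Suc n)"
        then have "F v - F u \<ge> p * (v - u)" using n unfolding lo_def by force
        moreover have "(D - e) * (v - u) \<le> p * (v - u)" using uv p by (intro mult_right_mono) auto
        ultimately show "(D - e) * (v - u) \<le> F v - F u" by linarith
      qed simp
    next
      case False
      show ?thesis
      proof (intro exI[of _ 1] conjI allI impI)
        fix u v assume uv: "u < x" "x < v"
        have "(D - e) * (v - u) \<le> 0" using False uv by (intro mult_nonpos_nonneg) auto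
        then show "(D - e) * (v - u) \<le> F v - F u" using mono[of u v] uv by linarith
      qed simp
    qed
    have est: "\<exists>d>0. \<forall>u v. u \<le> x \<longrightarrow> x \<le> v \<longrightarrow> v - u < d \<longrightarrow> \<bar>F v - F u - D * (v - u)\<bar> \<le> e * (v - u)" if e: "e > 0" for e
    proof -
      obtain d1 where d1: "d1 > 0" "\<And>u v. u < x \<Longrightarrow> x < v \<Longrightarrow> v - u < d1 \<Longrightarrow> F v - F u \<le> (D + e) * (v - u)"
        using up[OF e] by blast
      obtain d2 where d2: "d2 > 0" "\<And>u v. u < x \<Longrightarrow> x < v \<Longrightarrow> v - u < d2 \<Longrightarrow> F v - F u \<ge> (D - e) * (v - u)"
        using dn[OF e] by blast
      have "\<bar>F v - F u - D * (v - u)\<bar> \<le> e * (v - u)" if uv: "u \<le> x" "x \<le> v" "v - u < min d1 d2" for u v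
      proof -
        \<comment> \<open>So far \<open>x\<close> had to lie strictly inside the interval. Enlarging
          it by \<open>h\<close> on both sides and letting \<open>h\<close> tend to 0 admits
          \<open>x\<close> as an endpoint, which is the case that the derivative at \<open>x\<close>
          is about.\<close>
        have c: "isCont F y" for y using contF by (simp add: continuous_on_eq_continuous_within)
        have sh: "((\<lambda>h. F (v + h) - F (u - h)) \<longlongrightarrow> F (v + 0) - F (u - 0)) (at_right 0)"
          by (intro tendsto_intros isCont_tendsto_compose[OF c] isCont_tendsto_compose[OF c[of "u - 0"]])
        have ev: "eventually (\<lambda>h. h > 0 \<and> v - u + 2 * h < min d1 d2) (at_right (0::real))"
          using uv(3) by (auto simp: eventually_at_right_field intro!: exI[of _ "(min d1 d2 - (v - u)) / 2"])
        have 1: "F (v + 0) - F (u - 0) \<le> (D + e) * (v - u + 2 * 0)"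
        proof (rule tendsto_le[OF _ _ sh])
          show "((\<lambda>h. (D + e) * (v - u + 2 * h)) \<longlongrightarrow> (D + e) * (v - u + 2 * 0)) (at_right 0)"
            by (intro tendsto_intros)
          show "eventually (\<lambda>h. F (v + h) - F (u - h) \<le> (D + e) * (v - u + 2 * h)) (at_right 0)"
            using ev
          proof eventually_elim
            case (elim h)
            then show ?case using d1(2)[of "u - h" "v + h"] uv by (auto simp: algebra_simps)
          qed
        qed simp
        have 2: "(D - e) * (v - u + 2 * 0) \<le> F (v + 0) - F (u - 0)"
        proof (rule tendsto_le[OF _ sh])
          show "((\<lambda>h. (D - e) * (v - u + 2 * h)) \<longlongrightarrow> (D - e) * (v - u + 2 * 0)) (at_right 0)"
            by (intro tendsto_intros)
          show "eventually (\<lambda>h. (D - e) * (v - u + 2 * h) \<le> F (v + h) - F (u - h)) (at_right 0)"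
            using ev
          proof eventually_elim
            case (elim h)
            then show ?case using d2(2)[of "u - h" "v + h"] uv by (auto simp: algebra_simps)
          qed
        qed simp
        show ?thesis using 1 2 by (auto simp: algebra_simps abs_le_iff)
      qed
      then show ?thesis using d1(1) d2(1) by (intro exI[of _ "min d1 d2"]) auto
    qed
    have "(F has_derivative (\<lambda>h. h * D)) (at x)"
    proof (subst has_derivative_within_alt, intro conjI allI impI)
      show "bounded_linear (\<lambda>h. h * D)" by (rule bounded_linear_mult_left)
      fix e :: real assume "e > 0"
      from est[OF this] obtain d where d: "d > 0" "\<And>u v. u \<le> x \<Longrightarrow> x \<le> v \<Longrightarrow> v - u < d \<Longrightarrow> \<bar>F v - F u - D * (v - u)\<bar> \<le> e * (v - u)"
        by blast
      show "\<exists>d>0. \<forall>y\<in>UNIV. norm (y - x) < d \<longrightarrow> norm (F y - F x - (y - x) * D) \<le> e * norm (y - x)"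
      proof (intro exI[of _ d] conjI ballI impI)
        fix y assume y: "norm (y - x) < d"
        show "norm (F y - F x - (y - x) * D) \<le> e * norm (y - x)"
        proof (cases "x \<le> y")
          case True
          then show ?thesis using d(2)[of x y] y by (simp add: mult.commute)
        next
          case False
          then have "\<bar>F x - F y - D * (x - y)\<bar> \<le> e * (x - y)" using d(2)[of y x] y by simp
          moreover have "\<bar>F y - F x - (y - x) * D\<bar> = \<bar>F x - F y - D * (x - y)\<bar>"
            by (simp add: algebra_simps abs_minus_commute)
          ultimately show ?thesis using False by simp
        qed
      qed (rule d(1))
    qed
    then show ?thesis by (auto simp: differentiable_def)
  qed
  ultimately show ?thesis by blast
qed

section \<open>Differentiation and integration of Lipschitz functions on an interval\<close>

lemma lipschitz_on_clamp:
  fixes f :: "real \<Rightarrow> 'a::metric_space"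
  assumes f: "L-lipschitz_on {a..b} f" and "a \<le> b"
  shows "L-lipschitz_on UNIV (\<lambda>x. f (max a (min b x)))"
proof (rule lipschitz_onI)
  show "0 \<le> L" using f by (rule lipschitz_on_nonneg)
  fix x y :: real
  have "dist (f (max a (min b x))) (f (max a (min b y))) \<le> L * dist (max a (min b x)) (max a (min b y))"
    using \<open>a \<le> b\<close> by (intro lipschitz_onD[OF f]) auto
  also have "\<dots> \<le> L * dist x y"
    using \<open>0 \<le> L\<close> by (intro mult_left_mono) (auto simp: dist_real_def max_def min_def)
  finally show "dist (f (max a (min b x))) (f (max a (min b y))) \<le> L * dist x y" .
qed

text \<open>The constant extension past the endpoints is rescaled to the monotone nonexpansive case:
  division by \<open>L + 1\<close> (positive even for \<open>L = 0\<close>) brings the slopes into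
  \<open>[-1, 1]\<close>, adding \<open>x\<close> makes the function monotone, and halving brings
  the slopes back below 1.\<close>

lemma Lipschitz_differentiable_AE:
  fixes f :: "real \<Rightarrow> real"
  assumes f: "L-lipschitz_on {a..b} f" and "a \<le> b"
  shows "\<exists>N. negligible N \<and> (\<forall>x\<in>{a..b} - N. f differentiable (at x within {a..b}))"
proof -
  define g where "g = (\<lambda>x. f (max a (min b x)))"
  have L: "L \<ge> 0" using f by (rule lipschitz_on_nonneg)
  have g: "\<bar>g x - g y\<bar> \<le> (L + 1) * \<bar>x - y\<bar>" for x y
    using lipschitz_onD[OF lipschitz_on_clamp[OF f \<open>a \<le> b\<close>], of x y]
    by (simp add: g_def dist_real_def distrib_right add_increasing2)
  define F where "F = (\<lambda>x. (g x / (L + 1) + x) / 2)"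
  have g': "\<bar>g x / (L + 1) - g y / (L + 1)\<bar> \<le> \<bar>x - y\<bar>" for x y
    using g[of x y] L by (simp add: diff_divide_distrib[symmetric] field_simps)
  obtain N where N: "negligible N" "\<And>x. x \<notin> N \<Longrightarrow> F differentiable (at x)"
  proof (atomize_elim, rule mono_Lipschitz_differentiable_AE[of F, simplified])
    fix x y :: real assume "x \<le> y"
    then have "\<bar>g x / (L + 1) - g y / (L + 1)\<bar> \<le> y - x" using g'[of x y] by simp
    then show "F x \<le> F y" "F y - F x \<le> y - x"
      unfolding F_def by argo+
  qed
  have "f differentiable (at x within {a..b})" if x: "x \<in> {a..b} - N" for x
  proof -
    have "(\<lambda>x. (L + 1) * (2 * F x - x)) differentiable (at x)"
      using N(2)[of x] x by (intro derivative_intros) auto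
    moreover have "(\<lambda>x. (L + 1) * (2 * F x - x)) = g"
      using L by (auto simp: F_def field_simps)
    ultimately have "g differentiable (at x within {a..b})"
      by (auto intro: differentiable_at_withinI)
    then show ?thesis
      by (rule differentiable_transform_within[where d = 1]) (use x in \<open>auto simp: g_def max_def min_def\<close>)
  qed
  then show ?thesis using N(1) by blast
qed

text \<open>Fixing the increments \<open>1 / Suc n\<close> turns the derivative into the limit of a
  sequence, the form that dominated convergence asks for.\<close>

lemma difference_quotient_LIMSEQ:
  fixes f :: "real \<Rightarrow> real"
  assumes "(f has_real_derivative D) (at x within S)"
    and S: "eventually (\<lambda>n. x + 1 / real (Suc n) \<in> S) sequentially"
  shows "(\<lambda>n. real (Suc n) * (f (x + 1 / real (Suc n)) - f x)) \<longlonglongrightarrow> D"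
proof -
  have "((\<lambda>y. (f y - f x) / (y - x)) \<longlongrightarrow> D) (at x within S)"
    using assms(1) by (simp add: has_field_derivative_iff)
  moreover have "filterlim (\<lambda>n. x + 1 / real (Suc n)) (at x within S) sequentially"
    unfolding filterlim_at
  proof
    show "\<forall>\<^sub>F n in sequentially. x + 1 / real (Suc n) \<in> S \<and> x + 1 / real (Suc n) \<noteq> x"
      using S by (auto elim!: eventually_mono)
    have "(\<lambda>n. x + 1 / real (Suc n)) \<longlonglongrightarrow> x + 0"
      by (intro tendsto_add tendsto_const LIMSEQ_Suc lim_1_over_n)
    then show "(\<lambda>n. x + 1 / real (Suc n)) \<longlonglongrightarrow> x" by simp
  qed
  ultimately have "(\<lambda>n. (f (x + 1 / real (Suc n)) - f x) / (x + 1 / real (Suc n) - x)) \<longlonglongrightarrow> D"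
    by (rule filterlim_compose)
  then show ?thesis by (simp add: mult.commute)
qed

text \<open>Dominated convergence for the difference quotients and their squares.\<close>

lemma Lipschitz_FTC:
  fixes f v :: "real \<Rightarrow> real"
  assumes f: "L-lipschitz_on {a..b} f" and ab: "a \<le> b" and N: "negligible N"
    and v: "\<And>x. x \<in> {a..b} - N \<Longrightarrow> (f has_real_derivative v x) (at x within {a..b})"
  shows "(v has_integral (f b - f a)) {a..b}" and "(\<lambda>x. (v x)\<^sup>2) integrable_on {a..b}"
proof -
  define g where "g = (\<lambda>x. f (max a (min b x)))"
  have gL: "L-lipschitz_on UNIV g" unfolding g_def by (rule lipschitz_on_clamp[OF f ab])
  then have contg: "continuous_on S g" for S
    using lipschitz_on_continuous_on continuous_on_subset by blast
  have L: "L \<ge> 0" using f by (rule lipschitz_on_nonneg)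
  have gf: "g x = f x" if "x \<in> {a..b}" for x using that by (auto simp: g_def)
  define q where "q = (\<lambda>n x. real (Suc n) * (g (x + 1 / real (Suc n)) - g x))"
  have contq: "continuous_on S (q n)" for S n
    unfolding q_def by (intro continuous_intros continuous_on_compose2[OF contg[of UNIV]]) auto
  have qL: "\<bar>q n x\<bar> \<le> L" for n x
  proof -
    have "\<bar>g (x + 1 / real (Suc n)) - g x\<bar> \<le> L * (1 / real (Suc n))"
      using lipschitz_onD[OF gL, of "x + 1 / real (Suc n)" x] by (simp add: dist_real_def)
    then have "real (Suc n) * \<bar>g (x + 1 / real (Suc n)) - g x\<bar> \<le> real (Suc n) * (L * (1 / real (Suc n)))"
      by (rule mult_left_mono) simp
    then show ?thesis by (simp add: q_def abs_mult del: of_nat_Suc)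
  qed
  \<comment> \<open>The endpoint \<open>b\<close> is discarded because forward quotients leave the
    interval there: \<open>g\<close> is constant beyond \<open>b\<close>, so they would tend to 0
    instead of \<open>v b\<close>.\<close>
  let ?N = "N \<union> {b}"
  have N': "negligible ?N" using N by simp
  let ?q = "\<lambda>n x. if x \<in> ?N then 0 else q n x" and ?v = "\<lambda>x. if x \<in> ?N then 0 else v x"
  have lim: "(\<lambda>n. ?q n x) \<longlonglongrightarrow> ?v x" if x: "x \<in> {a..b}" for x
  proof (cases "x \<in> ?N")
    case False
    then have "a \<le> x" "x < b" using x by auto
    have ev: "\<forall>\<^sub>F n in sequentially. x + 1 / real (Suc n) \<in> {a..b}"
    proof -
      have "\<forall>\<^sub>F n in sequentially. 1 / real (Suc n) < b - x"
        using \<open>x < b\<close> by (intro order_tendstoD(2)[OF LIMSEQ_Suc[OF lim_1_over_n]]) auto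
      then show ?thesis
        by eventually_elim (use \<open>a \<le> x\<close> in \<open>auto intro: add_nonneg_nonneg order_trans\<close>)
    qed
    have "(\<lambda>n. real (Suc n) * (f (x + 1 / real (Suc n)) - f x)) \<longlonglongrightarrow> v x"
      using False x by (intro difference_quotient_LIMSEQ[OF v ev]) auto
    then have "(\<lambda>n. q n x) \<longlonglongrightarrow> v x"
      by (rule Lim_transform_eventually)
        (use ev in \<open>eventually_elim, use x in \<open>auto simp: q_def gf\<close>\<close>)
    then show ?thesis using False by simp
  qed auto
  have intq: "?q n integrable_on {a..b}" "(\<lambda>x. (?q n x)\<^sup>2) integrable_on {a..b}" for n
  proof -
    have "q n integrable_on {a..b}" "(\<lambda>x. (q n x)\<^sup>2) integrable_on {a..b}"
      by (intro integrable_continuous_interval contq continuous_on_power)+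
    from this[THEN integrable_spike[OF _ N']]
    show "?q n integrable_on {a..b}" "(\<lambda>x. (?q n x)\<^sup>2) integrable_on {a..b}"
      by auto
  qed
  have "(\<lambda>x. (?v x)\<^sup>2) integrable_on {a..b}"
  proof (rule dominated_convergence(1)[where f = "\<lambda>n x. (?q n x)\<^sup>2" and h = "\<lambda>_. L\<^sup>2", OF intq(2)])
    show "(\<lambda>n. (?q n x)\<^sup>2) \<longlonglongrightarrow> (?v x)\<^sup>2" if "x \<in> {a..b}" for x
      by (rule tendsto_power[OF lim[OF that]])
    show "norm ((?q n x)\<^sup>2) \<le> L\<^sup>2" for n x
      using qL[of n x] L by (auto simp: abs_le_square_iff[symmetric])
  qed (rule integrable_const_ivl)
  then show "(\<lambda>x. (v x)\<^sup>2) integrable_on {a..b}"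
    by (rule integrable_spike[OF _ N']) simp
  have dc: "?v integrable_on {a..b}" "(\<lambda>n. integral {a..b} (?q n)) \<longlonglongrightarrow> integral {a..b} ?v"
  proof -
    have bnd: "norm (?q n x) \<le> L" for n x using qL[of n x] L by simp
    note dominated_convergence[where f = ?q and h = "\<lambda>_. L" and g = ?v,
      OF intq(1) integrable_const_ivl bnd lim]
    then show "?v integrable_on {a..b}" "(\<lambda>n. integral {a..b} (?q n)) \<longlonglongrightarrow> integral {a..b} ?v"
      by blast+
  qed
  \<comment> \<open>The larger interval keeps all shifted arguments \<open>x + 1 / Suc n\<close> in
    its interior, where \<open>G\<close> has a two-sided derivative.\<close>
  obtain G where *: "\<And>x. x \<in> {a-1..b+2} \<Longrightarrow> (G has_vector_derivative g x) (at x within {a-1..b+2})"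
    using antiderivative_continuous[OF contg] by blast
  have G: "(G has_real_derivative g x) (at x)" if "x \<in> {a..b+1}" for x
  proof -
    have "at x within {a-1..b+2} = at x" using that by (intro at_within_Icc_at) auto
    then show ?thesis
      using *[of x] that
      by (simp add: has_real_derivative_iff_has_vector_derivative)
  qed
  \<comment> \<open>Integrating a difference quotient of \<open>g\<close> leaves two difference
    quotients of its antiderivative, at \<open>b\<close> and at \<open>a\<close>; these tend to
    \<open>g b\<close> and \<open>g a\<close>.\<close>
  have iq: "integral {a..b} (?q n) = real (Suc n) * (G (b + 1 / real (Suc n)) - G b)
      - real (Suc n) * (G (a + 1 / real (Suc n)) - G a)" for n
  proof -
    have "(q n has_integral (real (Suc n) * (G (b + 1 / real (Suc n)) - G b)
      - real (Suc n) * (G (a + 1 / real (Suc n)) - G a))) {a..b}"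
    proof (rule fundamental_theorem_of_calculus[OF ab])
      fix x assume x: "x \<in> {a..b}"
      have "x + 1 / real (Suc n) \<in> {a..b+1}" using x by (auto intro: add_mono add_increasing2)
      then have "((\<lambda>x. G (x + 1 / real (Suc n))) has_real_derivative g (x + 1 / real (Suc n))) (at x)"
        using G[of "x + 1 / real (Suc n)"] by (simp add: DERIV_shift)
      then have "((\<lambda>x. real (Suc n) * (G (x + 1 / real (Suc n)) - G x)) has_real_derivative q n x) (at x)"
        unfolding q_def using x by (intro DERIV_cmult DERIV_diff G) auto
      then show "((\<lambda>x. real (Suc n) * (G (x + 1 / real (Suc n)) - G x)) has_vector_derivative q n x) (at x within {a..b})"
        by (simp add: has_real_derivative_iff_has_vector_derivative has_vector_derivative_at_within)
    qed
    then show ?thesis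
      by (intro integral_unique) (rule has_integral_spike[OF N'], auto)
  qed
  have "(\<lambda>n. integral {a..b} (?q n)) \<longlonglongrightarrow> g b - g a"
    unfolding iq using ab by (intro tendsto_diff difference_quotient_LIMSEQ[where S = UNIV] G) auto
  then have "integral {a..b} ?v = f b - f a"
    using LIMSEQ_unique[OF dc(2)] gf[of a] gf[of b] ab by simp
  then have "(?v has_integral f b - f a) {a..b}"
    using integrable_integral[OF dc(1)] by (simp only:)
  then show "(v has_integral f b - f a) {a..b}"
    by (intro has_integral_spike[OF N', of "{a..b}" v ?v]) auto
qed

section \<open>Verification for the scalar problem\<close>

text \<open>As \<open>h t = 0\<close>, \<open>- h r\<close> is the integral of \<open>w\<close> over
  \<open>{r..t}\<close>, and the claim is Cauchy-Schwarz, obtained by integrating the tangent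
  inequality \<open>2 * k * w s - k\<^sup>2 \<le> (w s)\<^sup>2\<close>.\<close>

lemma Lipschitz_square_le:
  fixes h w :: "real \<Rightarrow> real"
  assumes h: "L-lipschitz_on {0..t} h" and N: "negligible N"
    and w: "\<And>s. s \<in> {0..t} - N \<Longrightarrow> (h has_real_derivative w s) (at s within {0..t})"
    and r: "r \<in> {0..t}" and "h t = 0"
  shows "(h r)\<^sup>2 \<le> t * integral {0..t} (\<lambda>s. (w s)\<^sup>2)"
proof -
  have t0: "0 \<le> t" using r by simp
  have "L-lipschitz_on {r..t} h" using r by (intro lipschitz_on_subset[OF h]) auto
  moreover have "(h has_real_derivative w s) (at s within {r..t})" if "s \<in> {r..t} - N" for s
    using that r by (intro has_field_derivative_subset[OF w]) auto
  ultimately have wr: "(w has_integral - h r) {r..t}" "(\<lambda>s. (w s)\<^sup>2) integrable_on {r..t}"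
    using Lipschitz_FTC[of L r t h N w] r N \<open>h t = 0\<close> by auto
  have w0: "(\<lambda>s. (w s)\<^sup>2) integrable_on {0..t}"
    by (rule Lipschitz_FTC(2)[OF h t0 N w])
  have le: "integral {r..t} (\<lambda>s. (w s)\<^sup>2) \<le> integral {0..t} (\<lambda>s. (w s)\<^sup>2)"
    using r by (intro integral_subset_le wr w0) auto
  show ?thesis
  proof (cases "r = t")
    case True
    then show ?thesis using \<open>h t = 0\<close> t0 le by (simp add: integral_nonneg[OF w0])
  next
    case False
    then have "r < t" using r by simp
    \<comment> \<open>The mean of \<open>w\<close> over \<open>{r..t}\<close> is the tangent point
      that makes the integrated bound sharpest.\<close>
    define k where "k = - h r / (t - r)"
    have "((\<lambda>s. 2 * k * w s - k\<^sup>2) has_integral 2 * k * (- h r) - k\<^sup>2 * (t - r)) {r..t}"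
      using \<open>r < t\<close> has_integral_const_real[of "k\<^sup>2" r t]
      by (intro has_integral_diff has_integral_mult_right wr(1)) (simp add: mult.commute)
    moreover have "2 * k * w s - k\<^sup>2 \<le> (w s)\<^sup>2" for s
      using zero_le_power2[of "w s - k"] by (simp add: power2_diff mult_ac)
    ultimately have "2 * k * (- h r) - k\<^sup>2 * (t - r) \<le> integral {r..t} (\<lambda>s. (w s)\<^sup>2)"
      by (intro has_integral_le[OF _ integrable_integral[OF wr(2)]])
    moreover have "2 * k * (- h r) - k\<^sup>2 * (t - r) = (h r)\<^sup>2 / (t - r)"
    proof -
      have "2 * (- z / d) * (- z) - (- z / d)\<^sup>2 * d = z\<^sup>2 / d" if "d > 0" for z d :: real
        using that by (simp add: field_simps power2_eq_square)
      then show ?thesis using \<open>r < t\<close> by (simp add: k_def)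
    qed
    ultimately have "(h r)\<^sup>2 / (t - r) \<le> integral {0..t} (\<lambda>s. (w s)\<^sup>2)"
      using le by simp
    then have "(h r)\<^sup>2 \<le> (t - r) * integral {0..t} (\<lambda>s. (w s)\<^sup>2)"
      using \<open>r < t\<close> by (simp add: field_simps)
    also have "\<dots> \<le> t * integral {0..t} (\<lambda>s. (w s)\<^sup>2)"
      using r by (intro mult_right_mono integral_nonneg w0) auto
    finally show ?thesis .
  qed
qed

text \<open>The Pontryagin conditions for the scalar problem with initial cost \<open>p * y 0\<close>: \<open>m\<close> is the
  costate, which equals the velocity, and \<open>\<xi>\<close> is a subgradient of \<open>- potential1 a b\<close> along
  the trajectory \<open>g\<close>.\<close>

definition extremal ::
    "real \<Rightarrow> real \<Rightarrow> real \<Rightarrow> real \<Rightarrow> real \<Rightarrow> real \<Rightarrow> (real \<Rightarrow> real) \<Rightarrow> bool" where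
  "extremal a b t p x V g \<longleftrightarrow> (\<exists>m \<xi> S Q L. finite S \<and> L-lipschitz_on {0..t} m \<and> m 0 = p \<and>
     (\<forall>s\<in>{0..t} - S. (m has_real_derivative \<xi> s) (at s within {0..t})) \<and>
     (\<forall>s\<in>{0..t}. - b \<le> \<xi> s \<and> \<xi> s \<le> a) \<and>
     ((\<lambda>s. (m s)\<^sup>2) has_integral Q) {0..t} \<and> V = m t * x - Q / 2 \<and> g t = x \<and>
     (\<forall>s\<in>{0..t}. (g has_real_derivative m s) (at s within {0..t})) \<and>
     (\<forall>s\<in>{0..t}. potential1 a b (g s) = - \<xi> s * g s))"

text \<open>Boundedness on the compact interval controls both terms of the product estimate. It is
  what allows the product of costate and competitor to be integrated by
  \<open>Lipschitz_FTC\<close>.\<close>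

lemma Lipschitz_mult:
  fixes f g :: "real \<Rightarrow> real"
  assumes f: "K-lipschitz_on {a..b} f" and g: "L-lipschitz_on {a..b} g"
  shows "\<exists>M. M-lipschitz_on {a..b} (\<lambda>s. f s * g s)"
proof -
  have "bounded (f ` {a..b})" "bounded (g ` {a..b})"
    by (intro compact_imp_bounded compact_continuous_image compact_Icc
        lipschitz_on_continuous_on[OF f] lipschitz_on_continuous_on[OF g])+
  then obtain A B where A: "A > 0" "\<forall>s\<in>{a..b}. \<bar>f s\<bar> \<le> A"
    and B: "B > 0" "\<forall>s\<in>{a..b}. \<bar>g s\<bar> \<le> B"
    unfolding bounded_pos by (metis image_eqI real_norm_def)
  have "(A * L + B * K)-lipschitz_on {a..b} (\<lambda>s. f s * g s)"
  proof (rule lipschitz_onI)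
    fix r s assume rs: "r \<in> {a..b}" "s \<in> {a..b}"
    have "\<bar>f r * g r - f s * g s\<bar> = \<bar>f r * (g r - g s) + g s * (f r - f s)\<bar>"
      by (simp add: algebra_simps)
    also have "\<dots> \<le> \<bar>f r\<bar> * \<bar>g r - g s\<bar> + \<bar>g s\<bar> * \<bar>f r - f s\<bar>"
      using abs_triangle_ineq[of "f r * (g r - g s)" "g s * (f r - f s)"] by (simp only: abs_mult)
    also have "\<dots> \<le> A * (L * \<bar>r - s\<bar>) + B * (K * \<bar>r - s\<bar>)"
      using lipschitz_onD[OF f rs] lipschitz_onD[OF g rs] A B rs
      by (intro add_mono mult_mono) (simp_all add: dist_real_def)
    finally show "dist (f r * g r) (f s * g s) \<le> (A * L + B * K) * dist r s"
      by (simp add: dist_real_def algebra_simps)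
  qed (use A B lipschitz_on_nonneg[OF f] lipschitz_on_nonneg[OF g] in auto)
  then show ?thesis by blast
qed

lemma bounded_deriv_Lipschitz:
  fixes g :: "real \<Rightarrow> real"
  assumes "\<And>s. s \<in> {a..b} \<Longrightarrow> (g has_real_derivative m s) (at s within {a..b})"
    and "continuous_on {a..b} m"
  shows "\<exists>L. L-lipschitz_on {a..b} g"
proof -
  have "bounded (m ` {a..b})"
    using assms(2) by (auto intro!: compact_imp_bounded compact_continuous_image)
  then obtain B where B: "B > 0" "\<And>s. s \<in> {a..b} \<Longrightarrow> \<bar>m s\<bar> \<le> B" by (auto simp: bounded_pos)
  have "B-lipschitz_on {a..b} g"
  proof (rule lipschitz_onI)
    fix r s assume "r \<in> {a..b}" "s \<in> {a..b}"
    then show "dist (g r) (g s) \<le> B * dist r s"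
      using field_differentiable_bound[of "{a..b}" g m B s r] assms(1) B
      by (auto simp: dist_real_def abs_minus_commute)
  qed (use B in simp)
  then show ?thesis by blast
qed

lemma extremal_Lipschitz:
  assumes "extremal a b t p x V g"
  shows "\<exists>L. L-lipschitz_on {0..t} g"
proof -
  from assms obtain m K where "K-lipschitz_on {0..t} m"
    "\<forall>s\<in>{0..t}. (g has_real_derivative m s) (at s within {0..t})"
    unfolding extremal_def by blast
  then show ?thesis
    by (intro bounded_deriv_Lipschitz[where m = m] lipschitz_on_continuous_on) auto
qed

lemma extremal_initial_derivative:
  assumes "extremal a b t p x V g" and "0 < t"
  shows "(g has_real_derivative p) (at 0 within {0..t})"
proof -
  from assms(1) obtain m where "m 0 = p"
    "\<forall>s\<in>{0..t}. (g has_real_derivative m s) (at s within {0..t})"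
    unfolding extremal_def by blast
  then show ?thesis using assms(2) by (metis atLeastAtMost_iff less_imp_le order_refl)
qed

text \<open>Minus the potential is the maximum of \<open>k * y\<close> over \<open>k\<close> in
  \<open>[-b, a]\<close>, so every such \<open>k\<close> gives a linear minorant. Along an extremal
  the value \<open>\<xi> s\<close> attains the maximum.\<close>

lemma potential1_le:
  assumes "- b \<le> k" "k \<le> a"
  shows "potential1 a b y \<le> - k * y"
proof (cases "y \<ge> 0")
  case True
  then show ?thesis using mult_right_mono[OF assms(2)] by (simp add: potential1_def)
next
  case False
  then show ?thesis using mult_right_mono_neg[OF assms(1), of y] by (simp add: potential1_def)
qed

lemma continuous_on_potential1: "continuous_on S (potential1 a b)"
proof -
  have "potential1 a b = (\<lambda>y. - a * max y 0 + b * min y 0)"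
    by (auto simp: potential1_def max_def min_def)
  then show ?thesis by (simp only:) (intro continuous_intros)
qed

text \<open>The velocity is a separate argument because a component of the vector derivative is
  known to be the derivative of that component only off a null set. The initial cost is left out, so
  that it can be taken linear or equal to \<open>\<Phi>\<close>.\<close>

definition cost1 :: "real \<Rightarrow> real \<Rightarrow> real \<Rightarrow> (real \<Rightarrow> real) \<Rightarrow> (real \<Rightarrow> real) \<Rightarrow> real" where
  "cost1 a b t v y = integral {0..t} (\<lambda>s. 1 / 2 * (v s)\<^sup>2 - potential1 a b (y s))"

lemma cost1_integrable:
  assumes y: "L-lipschitz_on {0..t} y" and t: "0 < t" and N: "negligible N"
    and v: "\<And>s. s \<in> {0..t} - N \<Longrightarrow> (y has_real_derivative v s) (at s within {0..t})"
  shows "(\<lambda>s. 1 / 2 * (v s)\<^sup>2 - potential1 a b (y s)) integrable_on {0..t}"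
proof -
  have "(\<lambda>s. (v s)\<^sup>2) integrable_on {0..t}"
    using Lipschitz_FTC(2)[OF y _ N v] t by simp
  then have "(\<lambda>s. 1 / 2 * (v s)\<^sup>2) integrable_on {0..t}"
    by (rule integrable_on_mult_right)
  then show ?thesis
    using lipschitz_on_continuous_on[OF y]
    by (intro integrable_diff[OF _ integrable_continuous_interval]
        continuous_on_compose2[OF continuous_on_potential1[of UNIV]]) auto
qed

text \<open>Completing the square: since \<open>m' = \<xi>\<close>, the integrand \<open>v\<^sup>2 / 2 + \<xi> y\<close> equals
  \<open>(m y)' - m\<^sup>2 / 2 + (v - m)\<^sup>2 / 2\<close> almost everywhere.\<close>

lemma extremal_verification:
  assumes ext: "extremal a b t p x V g" and t: "0 < t"
    and y: "L-lipschitz_on {0..t} y" and N: "negligible N"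
    and v: "\<And>s. s \<in> {0..t} - N \<Longrightarrow> (y has_real_derivative v s) (at s within {0..t})"
    and yt: "y t = x"
  shows "\<And>r. r \<in> {0..t} \<Longrightarrow> V + (y r - g r)\<^sup>2 / (2 * t) \<le> cost1 a b t v y + p * y 0"
    and "(\<And>s. s \<in> {0..t} \<Longrightarrow> y s = g s) \<Longrightarrow> cost1 a b t v y + p * y 0 = V"
proof -
  from ext obtain m \<xi> S Q K where S: "finite S" and m: "K-lipschitz_on {0..t} m" and m0: "m 0 = p"
    and dm: "\<forall>s\<in>{0..t} - S. (m has_real_derivative \<xi> s) (at s within {0..t})"
    and \<xi>: "\<forall>s\<in>{0..t}. - b \<le> \<xi> s \<and> \<xi> s \<le> a"
    and Q: "((\<lambda>s. (m s)\<^sup>2) has_integral Q) {0..t}" and V: "V = m t * x - Q / 2" and gt: "g t = x"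
    and dg: "\<forall>s\<in>{0..t}. (g has_real_derivative m s) (at s within {0..t})"
    and pg: "\<forall>s\<in>{0..t}. potential1 a b (g s) = - \<xi> s * g s"
    unfolding extremal_def by blast
  have t0: "0 \<le> t" using t by simp
  \<comment> \<open>The product rule for \<open>m s * y s\<close> fails possibly at the null set of
    the competitor and at the corners of \<open>m\<close>.\<close>
  have NS: "negligible (N \<union> S)" using N S by (simp add: negligible_finite)
  obtain M where "M-lipschitz_on {0..t} (\<lambda>s. m s * y s)" using Lipschitz_mult[OF m y] by blast
  moreover have "((\<lambda>s. m s * y s) has_real_derivative \<xi> s * y s + m s * v s) (at s within {0..t})"
    if "s \<in> {0..t} - (N \<union> S)" for s
    using DERIV_mult[OF dm[rule_format, of s] v[of s]] that by (simp add: mult.commute add.commute)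
  ultimately have my: "((\<lambda>s. \<xi> s * y s + m s * v s) has_integral m t * y t - m 0 * y 0) {0..t}"
    by (rule Lipschitz_FTC(1)[OF _ t0 NS])
  obtain G where G: "G-lipschitz_on {0..t} g" using extremal_Lipschitz[OF ext] by blast
  have h: "(L + G)-lipschitz_on {0..t} (\<lambda>s. y s - g s)"
    using y G by (rule lipschitz_on_diff)
  have dh: "((\<lambda>s. y s - g s) has_real_derivative v s - m s) (at s within {0..t})"
    if "s \<in> {0..t} - N" for s using that by (intro DERIV_diff v dg[rule_format]) auto
  let ?W = "integral {0..t} (\<lambda>s. (v s - m s)\<^sup>2)"
  have W: "((\<lambda>s. (v s - m s)\<^sup>2) has_integral ?W) {0..t}"
    using Lipschitz_FTC(2)[OF h t0 N dh] by (rule integrable_integral)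
  have "((\<lambda>s. \<xi> s * y s + m s * v s - 1 / 2 * (m s)\<^sup>2 + 1 / 2 * (v s - m s)\<^sup>2)
      has_integral m t * y t - m 0 * y 0 - 1 / 2 * Q + 1 / 2 * ?W) {0..t}"
    by (intro has_integral_add has_integral_diff my has_integral_mult_right Q W)
  moreover have "(\<lambda>s. \<xi> s * y s + m s * v s - 1 / 2 * (m s)\<^sup>2 + 1 / 2 * (v s - m s)\<^sup>2)
      = (\<lambda>s. 1 / 2 * (v s)\<^sup>2 + \<xi> s * y s)"
    by (rule HOL.ext) (simp add: power2_eq_square algebra_simps)
  moreover have "m t * y t - m 0 * y 0 - 1 / 2 * Q + 1 / 2 * ?W = V - p * y 0 + ?W / 2"
    using V m0 yt by simp
  ultimately have I: "((\<lambda>s. 1 / 2 * (v s)\<^sup>2 + \<xi> s * y s) has_integral V - p * y 0 + ?W / 2) {0..t}"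
    by simp
  {
    fix r assume r: "r \<in> {0..t}"
    have "V - p * y 0 + ?W / 2 \<le> cost1 a b t v y"
      unfolding cost1_def
    proof (rule has_integral_le[OF I integrable_integral[OF cost1_integrable[OF y t N v]]])
      fix s assume "s \<in> {0..t}"
      then show "1 / 2 * (v s)\<^sup>2 + \<xi> s * y s \<le> 1 / 2 * (v s)\<^sup>2 - potential1 a b (y s)"
        using potential1_le[of b "\<xi> s" a "y s"] \<xi> by simp
    qed
    moreover have "(y r - g r)\<^sup>2 \<le> t * ?W"
      using Lipschitz_square_le[OF h N dh r] yt gt by simp
    then have "(y r - g r)\<^sup>2 / (2 * t) \<le> ?W / 2" using t by (simp add: field_simps)
    ultimately show "V + (y r - g r)\<^sup>2 / (2 * t) \<le> cost1 a b t v y + p * y 0" by linarith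
  }
  assume eq: "\<And>s. s \<in> {0..t} \<Longrightarrow> y s = g s"
  \<comment> \<open>Derivatives within a nondegenerate interval are unique, so the prescribed
    velocity is \<open>m\<close> off \<open>N\<close> and the excess vanishes.\<close>
  have "v s = m s" if "s \<in> {0..t} - N" for s
  proof -
    have "(g has_real_derivative v s) (at s within {0..t})"
      using v[OF that] eq that by (auto elim!: has_field_derivative_transform_within[where d = 1])
    moreover have "at s within {0..t} \<noteq> bot" using that t by (simp add: trivial_limit_within islimpt_Icc)
    ultimately show ?thesis
      using dg that has_field_derivative_unique by blast
  qed
  then have "((\<lambda>s. (v s - m s)\<^sup>2) has_integral 0) {0..t}"
    by (intro has_integral_spike[OF N _ has_integral_0]) simp
  then have "?W = 0" by (rule integral_unique)
  moreover have "((\<lambda>s. 1 / 2 * (v s)\<^sup>2 - potential1 a b (y s)) has_integral V - p * y 0 + ?W / 2) {0..t}"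
    by (rule has_integral_eq[OF _ I]) (use eq pg in auto)
  then have "cost1 a b t v y = V - p * y 0 + ?W / 2"
    unfolding cost1_def by (rule integral_unique)
  ultimately show "cost1 a b t v y + p * y 0 = V" by simp
qed

text \<open>Reflection at the origin exchanges the slopes \<open>a\<close> and \<open>b\<close> of
  the potential and reverses velocity and force; negative \<open>p\<close> is thereby reduced to
  positive \<open>p\<close>.\<close>

lemma extremal_reflect:
  assumes "extremal b a t (- p) (- x) V g"
  shows "extremal a b t p x V (\<lambda>s. - g s)"
proof -
  from assms obtain m \<xi> S Q K where *: "finite S" "K-lipschitz_on {0..t} m" "m 0 = - p"
    "\<forall>s\<in>{0..t} - S. (m has_real_derivative \<xi> s) (at s within {0..t})"
    "\<forall>s\<in>{0..t}. - a \<le> \<xi> s \<and> \<xi> s \<le> b"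
    "((\<lambda>s. (m s)\<^sup>2) has_integral Q) {0..t}" "V = m t * (- x) - Q / 2" "g t = - x"
    "\<forall>s\<in>{0..t}. (g has_real_derivative m s) (at s within {0..t})"
    and pg: "\<forall>s\<in>{0..t}. potential1 b a (g s) = - \<xi> s * g s"
    unfolding extremal_def by blast
  have "potential1 a b (- y) = potential1 b a y" for y by (auto simp: potential1_def)
  then have "\<forall>s\<in>{0..t}. potential1 a b (- g s) = - (- \<xi> s) * (- g s)"
    using pg by simp
  moreover have "K-lipschitz_on {0..t} (\<lambda>s. - m s)"
    using *(2) by (simp add: lipschitz_on_def dist_minus)
  moreover have "\<forall>s\<in>{0..t} - S. ((\<lambda>s. - m s) has_real_derivative - \<xi> s) (at s within {0..t})"
    "\<forall>s\<in>{0..t}. ((\<lambda>s. - g s) has_real_derivative - m s) (at s within {0..t})"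
    using *(4,9) by (auto intro: DERIV_minus)
  moreover have "\<forall>s\<in>{0..t}. - b \<le> - \<xi> s \<and> - \<xi> s \<le> a"
    using *(5) by (simp add: minus_le_iff)
  ultimately show ?thesis
    unfolding extremal_def using *
    by (intro exI[of _ "\<lambda>s. - m s"] exI[of _ "\<lambda>s. - \<xi> s"] exI[of _ S] exI[of _ Q] exI[of _ K] conjI)
      simp_all
qed

section \<open>The explicit trajectories\<close>

text \<open>The positive part of \<open>s - \<tau>\<close>. Its half square is continuously
  differentiable, so a trajectory with changing acceleration becomes one formula and
  differentiability at the switching times is settled once.\<close>

definition ramp :: "real \<Rightarrow> real \<Rightarrow> real" where "ramp \<tau> s = max 0 (s - \<tau>)"

lemma DERIV_ramp:
  assumes "s \<noteq> \<tau>"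
  shows "(ramp \<tau> has_real_derivative (if s < \<tau> then 0 else 1)) (at s)"
proof (cases "s < \<tau>")
  case True
  have "((\<lambda>_. 0::real) has_real_derivative 0) (at s)" by simp
  then have "(ramp \<tau> has_real_derivative 0) (at s)"
    by (rule has_field_derivative_transform_within_open[of _ _ _ "{..<\<tau>}"])
      (use True in \<open>auto simp: ramp_def\<close>)
  then show ?thesis using True by simp
next
  case False
  have "((\<lambda>s. s - \<tau>) has_real_derivative 1) (at s)" by (auto intro!: derivative_eq_intros)
  then have "(ramp \<tau> has_real_derivative 1) (at s)"
    by (rule has_field_derivative_transform_within_open[of _ _ _ "{\<tau><..}"])
      (use False assms in \<open>auto simp: ramp_def\<close>)
  then show ?thesis using False by simp
qed

lemma DERIV_ramp_square: "((\<lambda>s. (ramp \<tau> s)\<^sup>2 / 2) has_real_derivative ramp \<tau> s) (at s)"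
proof (cases "s = \<tau>")
  case False
  show ?thesis
    using DERIV_cdivide[OF DERIV_power[OF DERIV_ramp[OF False], of 2], of 2]
    by (auto simp: ramp_def split: if_splits)
next
  case True
  \<comment> \<open>At the corner the difference quotient of the half square is
    \<open>ramp \<tau> y / 2\<close> on both sides, and this tends to 0.\<close>
  have "((\<lambda>y. ramp \<tau> y / 2) \<longlongrightarrow> ramp \<tau> \<tau> / 2) (at \<tau>)"
    unfolding ramp_def by (intro tendsto_intros) auto
  moreover have "ramp \<tau> y / 2 = ((ramp \<tau> y)\<^sup>2 / 2 - (ramp \<tau> \<tau>)\<^sup>2 / 2) / (y - \<tau>)" if "y \<noteq> \<tau>" for y
  proof (cases "y < \<tau>")
    case True
    then show ?thesis by (simp add: ramp_def)
  next
    case False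
    then have "ramp \<tau> y = y - \<tau>" "y - \<tau> \<noteq> 0" using that by (auto simp: ramp_def)
    moreover have "z / 2 = (z\<^sup>2 / 2 - 0\<^sup>2 / 2) / z" if "z \<noteq> 0" for z :: real
      using that by (simp add: power2_eq_square)
    moreover have "ramp \<tau> \<tau> = 0" by (simp add: ramp_def)
    ultimately show ?thesis by (simp only:)
  qed
  then have "\<forall>\<^sub>F y in at \<tau>. ramp \<tau> y / 2 = ((ramp \<tau> y)\<^sup>2 / 2 - (ramp \<tau> \<tau>)\<^sup>2 / 2) / (y - \<tau>)"
    by (auto simp: eventually_at_filter)
  ultimately have "((\<lambda>y. ((ramp \<tau> y)\<^sup>2 / 2 - (ramp \<tau> \<tau>)\<^sup>2 / 2) / (y - \<tau>)) \<longlongrightarrow> ramp \<tau> \<tau> / 2) (at \<tau>)"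
    by (rule Lim_transform_eventually)
  then show ?thesis
    unfolding True has_field_derivative_iff by (simp add: ramp_def)
qed

lemma lipschitz_ramp: "1-lipschitz_on S (ramp \<tau>)"
  by (rule lipschitz_onI) (auto simp: ramp_def dist_real_def)

text \<open>Expanding in powers of \<open>v - u\<close> avoids a division by \<open>k\<close>, so
  the phase of constant velocity, \<open>k = 0\<close>, is included.\<close>

lemma has_integral_affine_square:
  fixes c k :: real
  assumes "u \<le> v"
  shows "((\<lambda>s. (c + k * (s - u))\<^sup>2) has_integral
    c\<^sup>2 * (v - u) + c * k * (v - u)\<^sup>2 + k\<^sup>2 * (v - u) ^ 3 / 3) {u..v}"
proof -
  let ?F = "\<lambda>s. c\<^sup>2 * (s - u) + c * k * (s - u)\<^sup>2 + k\<^sup>2 * (s - u) ^ 3 / 3"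
  have "((\<lambda>s. (c + k * (s - u))\<^sup>2) has_integral ?F v - ?F u) {u..v}"
  proof (rule fundamental_theorem_of_calculus[OF assms])
    fix s
    have "(?F has_real_derivative (c + k * (s - u))\<^sup>2) (at s within {u..v})"
      by (auto intro!: derivative_eq_intros) (simp add: power2_eq_square algebra_simps)
    then show "(?F has_vector_derivative (c + k * (s - u))\<^sup>2) (at s within {u..v})"
      by (simp add: has_real_derivative_iff_has_vector_derivative)
  qed
  then show ?thesis by simp
qed

text \<open>All explicit trajectories have this shape: the velocity has slope \<open>-b\<close> up to time \<open>\<tau>1\<close>, is
  constant until \<open>\<tau>2\<close>, and has slope \<open>\<sigma>\<close> afterwards; \<open>c\<close> is the middle velocity.\<close>

lemma extremal_piecewise:
  fixes p b \<sigma> \<tau>1 \<tau>2 :: real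
  defines "P \<equiv> \<lambda>s. p * s - b * (s\<^sup>2 / 2 - (ramp \<tau>1 s)\<^sup>2 / 2) + \<sigma> * ((ramp \<tau>2 s)\<^sup>2 / 2)"
  assumes ab: "0 < a" "0 < b" and \<sigma>: "- b \<le> \<sigma>" "\<sigma> \<le> a" and \<tau>: "0 \<le> \<tau>1" "\<tau>1 \<le> \<tau>2" "\<tau>2 \<le> t"
    and g: "\<And>s. s \<in> {0..t} \<Longrightarrow> g s = x - P t + P s"
    and g1: "\<And>s. 0 \<le> s \<Longrightarrow> s < \<tau>1 \<Longrightarrow> g s \<le> 0"
    and g2: "\<And>s. \<tau>1 \<le> s \<Longrightarrow> s < \<tau>2 \<Longrightarrow> g s = 0"
    and g3: "\<And>s. \<tau>2 \<le> s \<Longrightarrow> s \<le> t \<Longrightarrow> potential1 a b (g s) = - \<sigma> * g s"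
    and c: "c = p - b * \<tau>1"
    and V: "V = (c + \<sigma> * (t - \<tau>2)) * x - (p\<^sup>2 * \<tau>1 - p * b * \<tau>1\<^sup>2 + b\<^sup>2 * \<tau>1 ^ 3 / 3 + c\<^sup>2 * (\<tau>2 - \<tau>1)
      + (c\<^sup>2 * (t - \<tau>2) + c * \<sigma> * (t - \<tau>2)\<^sup>2 + \<sigma>\<^sup>2 * (t - \<tau>2) ^ 3 / 3)) / 2"
  shows "extremal a b t p x V g"
proof -
  define m where "m = (\<lambda>s. p - b * (s - ramp \<tau>1 s) + \<sigma> * ramp \<tau>2 s)"
  \<comment> \<open>While the trajectory rests at the origin every value in \<open>[-b, a]\<close>
    is a subgradient; 0 is the one that keeps the velocity constant.\<close>
  define \<xi> where "\<xi> = (\<lambda>s. if s < \<tau>1 then - b else if s < \<tau>2 then 0 else \<sigma>)"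
  have 1: "(\<bar>b\<bar> * (1 + 1) + \<bar>\<sigma>\<bar> * 1)-lipschitz_on {0..t} m"
  proof (rule lipschitz_onI)
    fix r s assume "r \<in> {0..t}" "s \<in> {0..t}"
    have r: "\<bar>ramp \<tau> r - ramp \<tau> s\<bar> \<le> \<bar>r - s\<bar>" for \<tau>
      using lipschitz_onD[OF lipschitz_ramp[of UNIV \<tau>], of r s] by (simp add: dist_real_def)
    have "\<bar>m r - m s\<bar> = \<bar>- b * (r - s) + b * (ramp \<tau>1 r - ramp \<tau>1 s) + \<sigma> * (ramp \<tau>2 r - ramp \<tau>2 s)\<bar>"
      by (simp add: m_def algebra_simps)
    also have "\<dots> \<le> \<bar>- b * (r - s)\<bar> + \<bar>b * (ramp \<tau>1 r - ramp \<tau>1 s)\<bar> + \<bar>\<sigma> * (ramp \<tau>2 r - ramp \<tau>2 s)\<bar>"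
      by linarith
    also have "\<dots> \<le> \<bar>b\<bar> * \<bar>r - s\<bar> + \<bar>b\<bar> * \<bar>r - s\<bar> + \<bar>\<sigma>\<bar> * \<bar>r - s\<bar>"
      unfolding abs_mult abs_minus_cancel by (intro add_mono mult_left_mono r) auto
    finally show "dist (m r) (m s) \<le> (\<bar>b\<bar> * (1 + 1) + \<bar>\<sigma>\<bar> * 1) * dist r s"
      by (simp add: dist_real_def algebra_simps)
  qed auto
  have 2: "\<forall>s\<in>{0..t} - {\<tau>1, \<tau>2}. (m has_real_derivative \<xi> s) (at s within {0..t})"
  proof
    fix s assume s: "s \<in> {0..t} - {\<tau>1, \<tau>2}"
    have "(m has_real_derivative - b * (1 - (if s < \<tau>1 then 0 else 1)) + \<sigma> * (if s < \<tau>2 then 0 else 1)) (at s)"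
      unfolding m_def using s
      by (auto intro!: derivative_eq_intros DERIV_ramp)
    moreover have "- b * (1 - (if s < \<tau>1 then 0 else 1)) + \<sigma> * (if s < \<tau>2 then 0 else 1) = \<xi> s"
      using s \<tau> by (auto simp: \<xi>_def)
    ultimately show "(m has_real_derivative \<xi> s) (at s within {0..t})"
      by (auto intro: has_field_derivative_at_within)
  qed
  have P: "(P has_real_derivative m s) (at s)" for s
    unfolding P_def m_def
    by (rule derivative_eq_intros DERIV_ramp_square refl | simp)+
  have 3: "\<forall>s\<in>{0..t}. (g has_real_derivative m s) (at s within {0..t})"
  proof
    fix s assume s: "s \<in> {0..t}"
    have "((\<lambda>s. x - P t + P s) has_real_derivative m s) (at s within {0..t})"
      using DERIV_add[OF DERIV_const has_field_derivative_at_within[OF P]] by simp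
    then show "(g has_real_derivative m s) (at s within {0..t})"
      by (rule has_field_derivative_transform_within[where d = 1]) (use s g in auto)
  qed
  have 4: "\<forall>s\<in>{0..t}. potential1 a b (g s) = - \<xi> s * g s"
  proof
    fix s assume "s \<in> {0..t}"
    then show "potential1 a b (g s) = - \<xi> s * g s"
      using g1[of s] g2[of s] g3[of s] by (auto simp: \<xi>_def potential1_def)
  qed
  \<comment> \<open>Left unsimplified so that each phase matches an instance of
    \<open>has_integral_affine_square\<close>, with slopes \<open>- b\<close>, \<open>0\<close> and
    \<open>\<sigma>\<close>.\<close>
  let ?Q = "p\<^sup>2 * (\<tau>1 - 0) + p * (- b) * (\<tau>1 - 0)\<^sup>2 + (- b)\<^sup>2 * (\<tau>1 - 0) ^ 3 / 3
    + (c\<^sup>2 * (\<tau>2 - \<tau>1) + c * 0 * (\<tau>2 - \<tau>1)\<^sup>2 + 0\<^sup>2 * (\<tau>2 - \<tau>1) ^ 3 / 3)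
    + (c\<^sup>2 * (t - \<tau>2) + c * \<sigma> * (t - \<tau>2)\<^sup>2 + \<sigma>\<^sup>2 * (t - \<tau>2) ^ 3 / 3)"
  have "((\<lambda>s. (m s)\<^sup>2) has_integral (p\<^sup>2 * (\<tau>1 - 0) + p * (- b) * (\<tau>1 - 0)\<^sup>2 + (- b)\<^sup>2 * (\<tau>1 - 0) ^ 3 / 3)) {0..\<tau>1}"
    by (rule has_integral_eq[OF _ has_integral_affine_square]) (use \<tau> in \<open>auto simp: m_def ramp_def\<close>)
  moreover have "((\<lambda>s. (m s)\<^sup>2) has_integral (c\<^sup>2 * (\<tau>2 - \<tau>1) + c * 0 * (\<tau>2 - \<tau>1)\<^sup>2 + 0\<^sup>2 * (\<tau>2 - \<tau>1) ^ 3 / 3)) {\<tau>1..\<tau>2}"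
    by (rule has_integral_eq[OF _ has_integral_affine_square]) (use \<tau> in \<open>auto simp: m_def ramp_def c\<close>)
  moreover have "((\<lambda>s. (m s)\<^sup>2) has_integral (c\<^sup>2 * (t - \<tau>2) + c * \<sigma> * (t - \<tau>2)\<^sup>2 + \<sigma>\<^sup>2 * (t - \<tau>2) ^ 3 / 3)) {\<tau>2..t}"
    by (rule has_integral_eq[OF _ has_integral_affine_square]) (use \<tau> in \<open>auto simp: m_def ramp_def c\<close>)
  ultimately have 5: "((\<lambda>s. (m s)\<^sup>2) has_integral ?Q) {0..t}"
    using \<tau> by (meson has_integral_combine order_trans)
  have 6: "V = m t * x - ?Q / 2"
    using V \<tau> by (simp add: m_def ramp_def c)
  have 7: "g t = x" using g[of t] \<tau> by simp
  have 8: "m 0 = p" using \<tau> by (simp add: m_def ramp_def)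
  have 9: "\<forall>s\<in>{0..t}. - b \<le> \<xi> s \<and> \<xi> s \<le> a"
    using ab \<sigma> by (auto simp: \<xi>_def)
  show ?thesis
    unfolding extremal_def
    by (rule exI[of _ m], rule exI[of _ \<xi>], rule exI[of _ "{\<tau>1, \<tau>2}"], rule exI[of _ ?Q],
        rule exI[of _ "\<bar>b\<bar> * (1 + 1) + \<bar>\<sigma>\<bar> * 1"]) (intro conjI 1 2 3 4 5 6 7 8 9, simp)
qed

section \<open>Pontryagin conditions in the five regions\<close>

lemma powr_three_halves: "0 \<le> y \<Longrightarrow> y powr (3 / 2) = sqrt y ^ 3" for y :: real
proof -
  assume y: "0 \<le> y"
  have "y powr (3 / 2) = (y powr (1 / 2)) powr 3" by (simp add: powr_powr)
  also have "\<dots> = sqrt y ^ 3" using y by (simp add: powr_half_sqrt powr_numeral)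
  finally show ?thesis .
qed

text \<open>The initial point \<open>x - p * t - a / 2 * t\<^sup>2\<close> is nonnegative in this
  region, and so is the velocity; the trajectory never leaves the right half-line. With both
  switching times 0 only the last phase remains.\<close>

lemma extremal_Omega1:
  assumes ab: "0 < a" "0 < b" and t: "0 < t" and p: "0 \<le> p" and x: "p * t + a / 2 * t\<^sup>2 \<le> x"
  shows "extremal a b t p x (f1 x t p a b) (\<lambda>s. gamma1 s x t p a b)"
proof (rule extremal_piecewise[where \<sigma> = a and ?\<tau>1.0 = 0 and ?\<tau>2.0 = 0])
  show "potential1 a b (gamma1 s x t p a b) = - a * gamma1 s x t p a b" if "0 \<le> s" "s \<le> t" for s
  proof -
    have "gamma1 s x t p a b = (x - p * t - a / 2 * t\<^sup>2) + p * s + a / 2 * s\<^sup>2"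
      by (simp add: gamma1_def algebra_simps)
    then have "0 \<le> gamma1 s x t p a b" using x p ab that by simp
    then show ?thesis by (simp add: potential1_def)
  qed
qed (use ab t p in \<open>auto simp: gamma1_def f1_def ramp_def power2_eq_square power3_eq_cube field_simps\<close>)

text \<open>The trajectory is a parabola in time with its peak at \<open>p / b\<close>. On
  \<open>[0, t]\<close> it is largest at \<open>t\<close> or at the peak, whichever comes first, and
  the two alternatives of the region say that this largest value is negative.\<close>

lemma extremal_Omega2:
  assumes ab: "0 < a" "0 < b" and t: "0 < t" and p: "0 \<le> p"
    and x: "x < 0 \<and> t < p / b \<or> x < - (b / 2) * (t - p / b)\<^sup>2 \<and> t \<ge> p / b"
  shows "extremal a b t p x (f2 x t p a b) (\<lambda>s. gamma2 s x t p a b)"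
proof (rule extremal_piecewise[where \<sigma> = "- b" and ?\<tau>1.0 = 0 and ?\<tau>2.0 = 0])
  show "potential1 a b (gamma2 s x t p a b) = - (- b) * gamma2 s x t p a b" if s: "0 \<le> s" "s \<le> t" for s
  proof -
    have *: "gamma2 s x t p a b = x + b / 2 * (t - p / b)\<^sup>2 - b / 2 * (s - p / b)\<^sup>2"
      using ab by (simp add: gamma2_def power2_eq_square field_simps)
    have "gamma2 s x t p a b < 0"
    proof (cases "t < p / b")
      case True
      then have "(p / b - t)\<^sup>2 \<le> (p / b - s)\<^sup>2" using s by (intro power_mono) auto
      then have "b / 2 * (t - p / b)\<^sup>2 \<le> b / 2 * (s - p / b)\<^sup>2"
        using ab by (simp add: power2_commute)
      then show ?thesis using * x True by simp
    next
      case False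
      have "0 \<le> b / 2 * (s - p / b)\<^sup>2" using ab by simp
      then show ?thesis using * x False by simp
    qed
    then show ?thesis by (simp add: potential1_def)
  qed
qed (use ab t p in \<open>auto simp: gamma2_def f2_def ramp_def power2_eq_square power3_eq_cube field_simps\<close>)

text \<open>In terms of the time \<open>\<tau>\<close> of passage through the origin, the velocity
  \<open>c\<close> there and the remaining time \<open>u\<close>, the radicand is the square of
  \<open>(a + b) * u + c\<close>. The fractional power disappears and a rational identity with
  denominators in \<open>a + 2 * b\<close> is left.\<close>

lemma f3_eq:
  fixes a b c u \<tau> :: real
  assumes "0 < a" "0 < b" "0 \<le> c" "0 \<le> u" and t: "t = \<tau> + u" and p: "p = c + b * \<tau>"
    and x: "x = c * u + a / 2 * u\<^sup>2"
  shows "f3 x t p a b = (c + a * u) * x - (p\<^sup>2 * \<tau> - p * b * \<tau>\<^sup>2 + b\<^sup>2 * \<tau> ^ 3 / 3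
      + (c\<^sup>2 * u + c * a * u\<^sup>2 + a\<^sup>2 * u ^ 3 / 3)) / 2"
proof -
  have "(b * t - p)\<^sup>2 + 2 * x * (a + 2 * b) = ((a + b) * u + c)\<^sup>2"
    by (simp add: t p x power2_eq_square algebra_simps)
  then have *: "((b * t - p)\<^sup>2 + 2 * x * (a + 2 * b)) powr (3 / 2) = ((a + b) * u + c) ^ 3"
    using assms(1-4) by (simp add: powr_three_halves)
  define D where "D = a + 2 * b"
  have D: "D > 0" "a = D - 2 * b" using assms(1,2) by (auto simp: D_def)
  have w: "b * t - p = b * u - c" by (simp add: t p algebra_simps)
  \<comment> \<open>The two bases add up to \<open>D * u\<close>, so factoring the sum of cubes
    cancels one power of \<open>D\<close>.\<close>
  have cube: "(b * u - c) ^ 3 + ((a + b) * u + c) ^ 3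
     = D * u * ((b * u - c)\<^sup>2 - (b * u - c) * ((a + b) * u + c) + ((a + b) * u + c)\<^sup>2)"
    by (simp add: D_def power2_eq_square power3_eq_cube algebra_simps)
  have "f3 x t p a b = (a + b) / (3 * D\<^sup>2) * ((b * u - c) ^ 3 + ((a + b) * u + c) ^ 3)
      - b / D * (b * u - c) * x - b\<^sup>2 / 6 * t ^ 3 + b / 2 * p * t\<^sup>2 - 1 / 2 * p\<^sup>2 * t"
    by (unfold f3_def *, unfold w D_def, rule refl)
  also have "\<dots> = (a + b) * u / (3 * D) * ((b * u - c)\<^sup>2 - (b * u - c) * ((a + b) * u + c) + ((a + b) * u + c)\<^sup>2)
      - b / D * (b * u - c) * x - b\<^sup>2 / 6 * t ^ 3 + b / 2 * p * t\<^sup>2 - 1 / 2 * p\<^sup>2 * t"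
    unfolding cube using D(1) by (simp add: power2_eq_square)
  also have "\<dots> = (c + a * u) * x - (p\<^sup>2 * \<tau> - p * b * \<tau>\<^sup>2 + b\<^sup>2 * \<tau> ^ 3 / 3
      + (c\<^sup>2 * u + c * a * u\<^sup>2 + a\<^sup>2 * u ^ 3 / 3)) / 2"
    unfolding t p x D(2) using D(1) by (simp add: field_simps) algebra
  finally show ?thesis .
qed

text \<open>\<open>u\<close> is the larger root of \<open>D * u\<^sup>2 - 2 * w * u = 2 * x\<close>.
  This equation says that the trajectory gets from the origin to \<open>x\<close> in time
  \<open>u\<close> with acceleration \<open>a\<close>, after its velocity fell from \<open>p\<close>
  at rate \<open>b\<close> during \<open>t - u\<close>. The upper bound on \<open>x\<close> gives
  \<open>u \<le> t\<close>; the lower bounds give a nonnegative velocity \<open>c\<close> at the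
  origin.\<close>

lemma extremal_Omega3:
  assumes ab: "0 < a" "0 < b" and t: "0 < t" and p: "0 \<le> p" and x: "0 \<le> x" "x < p * t + a / 2 * t\<^sup>2"
    and x': "p / b \<le> t \<Longrightarrow> a / 2 * (t - p / b)\<^sup>2 \<le> x"
  shows "extremal a b t p x (f3 x t p a b) (\<lambda>s. gamma3 s x t p a b)"
proof -
  define D where "D = 2 * b + a"
  define w where "w = b * t - p"
  define S where "S = sqrt (w\<^sup>2 + 2 * D * x)"
  define u where "u = (w + S) / D"
  define \<tau> where "\<tau> = t - u"
  define c where "c = p - b * \<tau>"
  have D: "D > 0" using ab by (simp add: D_def)
  have S2: "S\<^sup>2 = w\<^sup>2 + 2 * D * x" and S0: "S \<ge> 0" using D x by (auto simp: S_def)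
  have tau: "tau3 x t p a b = \<tau>"
    using D by (simp add: tau3_def \<tau>_def u_def S_def w_def D_def field_simps)
  have Du: "D * u = w + S" using D by (simp add: u_def)
  have "\<bar>w\<bar> \<le> S" using S2 D x by (intro power2_le_imp_le[OF _ S0]) simp
  then have u0: "0 \<le> u" using D by (simp add: u_def)
  have ut: "u \<le> t"
  proof -
    have Dt: "D * t - w \<ge> 0" using ab t p by (simp add: D_def w_def algebra_simps)
    have "(D * t - w)\<^sup>2 - S\<^sup>2 = 2 * D * (p * t + a / 2 * t\<^sup>2 - x)"
      unfolding S2 by (simp add: D_def w_def power2_eq_square algebra_simps)
    also have "\<dots> \<ge> 0" using D x by simp
    finally have "S \<le> D * t - w" by (intro power2_le_imp_le[OF _ Dt]) simp
    then have "D * u \<le> D * t" using Du by simp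
    then show ?thesis using D by simp
  qed
  have cw: "c = b * u - w" by (simp add: c_def \<tau>_def w_def algebra_simps)
  have c0: "0 \<le> c"
  proof (cases "w \<le> 0")
    case True
    then show ?thesis using cw mult_nonneg_nonneg[of b u] u0 ab by linarith
  next
    case False
    \<comment> \<open>\<open>v\<close> is the time left when the velocity \<open>p - b * s\<close>
      would vanish, at \<open>s = p / b\<close>. Showing \<open>v \<le> u\<close> means that the
      origin is reached no later than that.\<close>
    define v where "v = w / b"
    have wv: "w = b * v" and v: "v > 0" using False ab by (auto simp: v_def)
    have vt: "v = t - p / b" using ab by (simp add: v_def w_def field_simps)
    have "a / 2 * v\<^sup>2 \<le> x" using x' v vt by simp
    then have "2 * D * (a / 2 * v\<^sup>2) \<le> 2 * D * x" using D by (intro mult_left_mono) auto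
    moreover have "((a + b) * v)\<^sup>2 = w\<^sup>2 + 2 * D * (a / 2 * v\<^sup>2)"
      by (simp add: wv D_def power2_eq_square algebra_simps)
    ultimately have "(a + b) * v \<le> S" using S2 by (intro power2_le_imp_le[OF _ S0]) simp
    then have "D * v \<le> D * u" unfolding Du by (simp add: wv D_def algebra_simps)
    then have "b * v \<le> b * u" using D ab by simp
    then show ?thesis using cw wv by simp
  qed
  have xu: "x = c * u + a / 2 * u\<^sup>2"
  proof -
    have "2 * D * (c * u + a / 2 * u\<^sup>2) = (D * u) * (D * u - 2 * w)"
      by (simp add: cw D_def power2_eq_square algebra_simps)
    also have "\<dots> = S\<^sup>2 - w\<^sup>2" unfolding Du by (simp add: power2_eq_square algebra_simps)
    also have "\<dots> = 2 * D * x" using S2 by simp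
    finally show ?thesis using D by simp
  qed
  have V: "f3 x t p a b = (c + a * u) * x - (p\<^sup>2 * \<tau> - p * b * \<tau>\<^sup>2 + b\<^sup>2 * \<tau> ^ 3 / 3
      + (c\<^sup>2 * u + c * a * u\<^sup>2 + a\<^sup>2 * u ^ 3 / 3)) / 2"
    by (rule f3_eq[OF ab c0 u0 _ _ xu]) (auto simp: \<tau>_def c_def)
  have gm: "gamma3 s x t p a b = (if s < \<tau> then - p * (\<tau> - s) + b / 2 * (\<tau>\<^sup>2 - s\<^sup>2)
      else (p - b * \<tau>) * (s - \<tau>) + a / 2 * (s - \<tau>)\<^sup>2)" for s
    by (simp add: gamma3_def Let_def tau)
  have t_eq: "t = \<tau> + u" and p_eq: "p = c + b * \<tau>" by (auto simp: \<tau>_def c_def)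
  show ?thesis
  proof (rule extremal_piecewise[where \<sigma> = a and ?\<tau>1.0 = \<tau> and ?\<tau>2.0 = \<tau> and c = c])
    show "0 \<le> \<tau>" "\<tau> \<le> t" using ut u0 by (auto simp: \<tau>_def)
    show "gamma3 s x t p a b = x
         - (p * t - b * (t\<^sup>2 / 2 - (ramp \<tau> t)\<^sup>2 / 2) + a * ((ramp \<tau> t)\<^sup>2 / 2))
         + (p * s - b * (s\<^sup>2 / 2 - (ramp \<tau> s)\<^sup>2 / 2) + a * ((ramp \<tau> s)\<^sup>2 / 2))" if "s \<in> {0..t}" for s
    proof -
      have R: "ramp \<tau> t = u" "ramp \<tau> s = (if s < \<tau> then 0 else s - \<tau>)"
        using u0 by (auto simp: ramp_def \<tau>_def)
      show ?thesis
        unfolding R gm unfolding xu t_eq p_eq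
        by (cases "s < \<tau>") (simp_all add: power2_eq_square field_simps)
    qed
    show "gamma3 s x t p a b \<le> 0" if "0 \<le> s" "s < \<tau>" for s
    proof -
      have "gamma3 s x t p a b = - (\<tau> - s) * (c + b / 2 * (\<tau> - s))"
        unfolding gm unfolding p_eq using that by (simp add: power2_eq_square field_simps)
      then show ?thesis using that c0 ab by (simp add: mult_nonpos_nonneg)
    qed
    show "potential1 a b (gamma3 s x t p a b) = - a * gamma3 s x t p a b" if "\<tau> \<le> s" "s \<le> t" for s
    proof -
      have "gamma3 s x t p a b = c * (s - \<tau>) + a / 2 * (s - \<tau>)\<^sup>2"
        unfolding gm unfolding p_eq using that by simp
      then have "0 \<le> gamma3 s x t p a b" using that c0 ab by simp
      then show ?thesis by (simp add: potential1_def)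
    qed
    show "f3 x t p a b = (c + a * (t - \<tau>)) * x - (p\<^sup>2 * \<tau> - p * b * \<tau>\<^sup>2 + b\<^sup>2 * \<tau> ^ 3 / 3
      + c\<^sup>2 * (\<tau> - \<tau>) + (c\<^sup>2 * (t - \<tau>) + c * a * (t - \<tau>)\<^sup>2 + a\<^sup>2 * (t - \<tau>) ^ 3 / 3)) / 2"
      unfolding V by (simp add: \<tau>_def)
  qed (use ab c_def in auto)
qed

text \<open>Both remaining regions: the trajectory rests at the origin during \<open>[p / b, t - r)\<close> and leaves
  it with acceleration \<open>\<sigma> \<in> {a, -b}\<close>.\<close>

lemma extremal_resting:
  fixes \<sigma> r :: real
  assumes ab: "0 < a" "0 < b" and \<sigma>: "\<sigma> = a \<or> \<sigma> = - b" and p: "0 \<le> p" and r: "0 \<le> r" "r \<le> t - p / b"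
    and x: "x = \<sigma> / 2 * r\<^sup>2"
    and g: "\<And>s. g s = (if s < p / b then - (1 / (2 * b)) * (p - b * s)\<^sup>2
      else if s < t - r then 0 else \<sigma> / 2 * (s - t + r)\<^sup>2)"
  shows "extremal a b t p x (\<sigma>\<^sup>2 / 3 * r ^ 3 - p ^ 3 / (6 * b)) g"
proof -
  \<comment> \<open>Starting at \<open>- p\<^sup>2 / (2 * b)\<close> with velocity \<open>p\<close>,
    the deceleration \<open>b\<close> brings the trajectory to a stop exactly at the origin at time
    \<open>q\<close>.\<close>
  define q where "q = p / b"
  have q: "p = b * q" "0 \<le> q" "r \<le> t - q" using ab p r by (auto simp: q_def)
  have qb: "p / b = q" by (simp add: q_def)
  have g': "g s = (if s < q then - (b / 2) * (q - s)\<^sup>2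
      else if s < t - r then 0 else \<sigma> / 2 * (s - t + r)\<^sup>2)" for s
    unfolding g qb using ab by (simp add: q(1) power2_eq_square field_simps)
  show ?thesis
  proof (rule extremal_piecewise[where \<sigma> = \<sigma> and ?\<tau>1.0 = q and ?\<tau>2.0 = "t - r" and c = 0])
    show "g s = x - (p * t - b * (t\<^sup>2 / 2 - (ramp q t)\<^sup>2 / 2) + \<sigma> * ((ramp (t - r) t)\<^sup>2 / 2))
         + (p * s - b * (s\<^sup>2 / 2 - (ramp q s)\<^sup>2 / 2) + \<sigma> * ((ramp (t - r) s)\<^sup>2 / 2))" if "s \<in> {0..t}" for s
    proof -
      have R: "ramp q t = t - q" "ramp (t - r) t = r" "ramp q s = (if s < q then 0 else s - q)"
        "ramp (t - r) s = (if s < t - r then 0 else s - t + r)"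
        using q r by (auto simp: ramp_def)
      consider "s < q" "s < t - r" | "\<not> s < q" "s < t - r" | "\<not> s < q" "\<not> s < t - r"
        using q by linarith
      then show ?thesis
        unfolding g' x q(1) R by cases (simp_all add: power2_eq_square field_simps)
    qed
    show "\<sigma>\<^sup>2 / 3 * r ^ 3 - p ^ 3 / (6 * b) = (0 + \<sigma> * (t - (t - r))) * x - (p\<^sup>2 * q - p * b * q\<^sup>2 + b\<^sup>2 * q ^ 3 / 3
      + 0\<^sup>2 * (t - r - q) + (0\<^sup>2 * (t - (t - r)) + 0 * \<sigma> * (t - (t - r))\<^sup>2 + \<sigma>\<^sup>2 * (t - (t - r)) ^ 3 / 3)) / 2"
      unfolding q(1) x using ab by (simp add: power2_eq_square power3_eq_cube field_simps)
    show "potential1 a b (g s) = - \<sigma> * g s" if "t - r \<le> s" "s \<le> t" for s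
    proof -
      have "g s = \<sigma> / 2 * (s - t + r)\<^sup>2" using that q by (simp add: g')
      moreover have "0 \<le> a / 2 * (s - t + r)\<^sup>2" "0 \<le> b / 2 * (s - t + r)\<^sup>2" using ab by simp_all
      ultimately show ?thesis using \<sigma> by (auto simp: potential1_def)
    qed
  qed (use ab \<sigma> q r in \<open>auto simp: g'\<close>)
qed

lemma extremal_nonneg:
  assumes ab: "0 < a" "0 < b" and t: "0 < t" and p: "0 \<le> p"
  shows "extremal a b t p x (V_nonneg x t p a b) (\<lambda>s. gamma_nonneg s x t p a b)"
proof -
  consider (1) "(x, t, p) \<in> Omega1 a b"
    | (2) "(x, t, p) \<notin> Omega1 a b" "(x, t, p) \<in> Omega2 a b"
    | (3) "(x, t, p) \<notin> Omega1 a b" "(x, t, p) \<notin> Omega2 a b" "(x, t, p) \<in> Omega3 a b"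
    | (4) "(x, t, p) \<notin> Omega1 a b" "(x, t, p) \<notin> Omega2 a b" "(x, t, p) \<notin> Omega3 a b" "(x, t, p) \<in> Omega4 a b"
    | (5) "(x, t, p) \<notin> Omega1 a b" "(x, t, p) \<notin> Omega2 a b" "(x, t, p) \<notin> Omega3 a b" "(x, t, p) \<notin> Omega4 a b"
    by blast
  then show ?thesis
  proof cases
    case 1
    then show ?thesis using extremal_Omega1[OF ab t p, of x]
      by (simp add: V_nonneg_def gamma_nonneg_def Omega1_def)
  next
    case 2
    then show ?thesis using extremal_Omega2[OF ab t p, of x]
      by (simp add: V_nonneg_def gamma_nonneg_def Omega2_def)
  next
    case 3
    moreover have "0 \<le> a / 2 * (t - p / b)\<^sup>2" using ab by simp
    ultimately have "0 \<le> x" "x < p * t + a / 2 * t\<^sup>2" "p / b \<le> t \<Longrightarrow> a / 2 * (t - p / b)\<^sup>2 \<le> x"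
      by (auto simp: Omega3_def)
    from extremal_Omega3[OF ab t p this] show ?thesis
      using 3 by (simp add: V_nonneg_def gamma_nonneg_def)
  next
    case 4
    then have x: "0 \<le> x" "x < a / 2 * (t - p / b)\<^sup>2" "p / b \<le> t" by (auto simp: Omega4_def)
    define r where "r = sqrt (2 * x / a)"
    have r: "0 \<le> r" "r\<^sup>2 = 2 * x / a" using ab x by (auto simp: r_def)
    have "a * r\<^sup>2 = 2 * x" using r ab by simp
    then have "a * r\<^sup>2 \<le> a * (t - p / b)\<^sup>2" using x by linarith
    then have "r\<^sup>2 \<le> (t - p / b)\<^sup>2" using ab by simp
    \<comment> \<open>The departure time \<open>t - r\<close> is thus not earlier than the arrival
      time \<open>p / b\<close>.\<close>
    then have rt: "r \<le> t - p / b" by (rule power2_le_imp_le) (use x in simp)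
    have xr: "x = a / 2 * r\<^sup>2" using r ab by simp
    have "extremal a b t p x (a\<^sup>2 / 3 * r ^ 3 - p ^ 3 / (6 * b)) (\<lambda>s. gamma4 s x t p a b)"
      by (rule extremal_resting[OF ab disjI1[OF refl] p r(1) rt xr]) (simp only: gamma4_def r_def)
    moreover have "f4 x t p a b = a\<^sup>2 / 3 * r ^ 3 - p ^ 3 / (6 * b)"
      unfolding f4_def r_def by (subst powr_three_halves) (use ab x in auto)
    ultimately show ?thesis
      using 4 by (simp add: V_nonneg_def gamma_nonneg_def)
  next
    case 5
    \<comment> \<open>The last branch is a default, so its region is recovered by exclusion:
      \<open>x \<ge> 0\<close> would fall under the first, third or fourth region, and exclusion
      from the second gives the bounds that follow.\<close>
    have x: "x < 0"
      using 5 t p by (auto simp: Omega1_def Omega3_def Omega4_def not_le not_less)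
    then have x': "- (b / 2) * (t - p / b)\<^sup>2 \<le> x" "p / b \<le> t"
      using 5 t p by (auto simp: Omega2_def not_le not_less)
    define r where "r = sqrt (2 * \<bar>x\<bar> / b)"
    have "0 \<le> - 2 * x / b" using ab x by (intro divide_nonneg_pos) auto
    then have r: "0 \<le> r" "r\<^sup>2 = - 2 * x / b" using x by (auto simp: r_def)
    have "b * r\<^sup>2 = - 2 * x" using r ab by simp
    then have "b * r\<^sup>2 \<le> b * (t - p / b)\<^sup>2" using x' by linarith
    then have "r\<^sup>2 \<le> (t - p / b)\<^sup>2" using ab by simp
    then have rt: "r \<le> t - p / b" by (rule power2_le_imp_le) (use x' in simp)
    have xr: "x = - b / 2 * r\<^sup>2" using r ab by simp
    have "extremal a b t p x ((- b)\<^sup>2 / 3 * r ^ 3 - p ^ 3 / (6 * b)) (\<lambda>s. gamma5 s x t p a b)"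
      by (rule extremal_resting[OF ab disjI2[OF refl] p r(1) rt xr])
        (simp only: gamma5_def r_def minus_divide_left)
    moreover have "f5 x t p a b = (- b)\<^sup>2 / 3 * r ^ 3 - p ^ 3 / (6 * b)"
    proof -
      have "0 \<le> - 2 * x / b" using ab x by (intro divide_nonneg_pos) auto
      from powr_three_halves[OF this] show ?thesis
        unfolding f5_def r_def using x by (simp only: abs_of_neg power2_minus mult_minus_left mult_minus_right)
    qed
    ultimately show ?thesis
      using 5 by (simp add: V_nonneg_def gamma_nonneg_def)
  qed
qed

lemma extremal_expl:
  assumes "0 < a" "0 < b" "0 < t"
  shows "extremal a b t p x (V_expl x t p a b) (\<lambda>s. gamma_expl s x t p a b)"
proof (cases "0 \<le> p")
  case True
  then show ?thesis using extremal_nonneg[OF assms True, of x] by (simp add: V_expl_def gamma_expl_def)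
next
  case False
  then show ?thesis
    using extremal_reflect[OF extremal_nonneg[OF assms(2,1,3), of "- p" "- x"]]
    by (simp add: V_expl_def gamma_expl_def)
qed

section \<open>Concave duality\<close>

text \<open>A hyperplane separates \<open>(z, f z)\<close> from the strict epigraph. It cannot be
  vertical: the epigraph lies over the whole space, and testing over \<open>z - u\<close> would
  force its normal to vanish. Dividing by the vertical component gives the subgradient.\<close>

lemma convex_subgradient_exists:
  fixes f :: "'a::euclidean_space \<Rightarrow> real"
  assumes f: "convex_on UNIV f"
  shows "\<exists>q. \<forall>y. f z + q \<bullet> (y - z) \<le> f y"
proof -
  let ?E = "{w. f (fst w) < snd w}"
  have "convex ?E"
  proof (rule convexI)
    fix v w and k l :: real assume vw: "v \<in> ?E" "w \<in> ?E" and kl: "0 \<le> k" "0 \<le> l" "k + l = 1"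
    have "f (k *\<^sub>R fst v + l *\<^sub>R fst w) \<le> k * f (fst v) + l * f (fst w)"
      using convex_onD[OF f, of l "fst v" "fst w"] kl by (simp add: eq_diff_eq[symmetric])
    also have "\<dots> < k * snd v + l * snd w"
    proof (cases "k = 0")
      case True
      then show ?thesis using kl vw by simp
    next
      case False
      then show ?thesis using kl vw by (intro add_less_le_mono mult_strict_left_mono mult_left_mono) auto
    qed
    finally show "k *\<^sub>R v + l *\<^sub>R w \<in> ?E" by simp
  qed
  moreover have "(z, f z + 1) \<in> ?E" by simp
  moreover have "{(z, f z)} \<inter> ?E = {}" by auto
  ultimately have "\<exists>d \<beta>. d \<noteq> 0 \<and> (\<forall>w\<in>{(z, f z)}. d \<bullet> w \<le> \<beta>) \<and> (\<forall>w\<in>?E. \<beta> \<le> d \<bullet> w)"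
    by (intro separating_hyperplane_sets) blast+
  then obtain d \<beta> where d: "d \<noteq> 0" "d \<bullet> (z, f z) \<le> \<beta>" "\<And>w. w \<in> ?E \<Longrightarrow> \<beta> \<le> d \<bullet> w"
    by (metis singletonI)
  obtain u \<rho> where ur: "d = (u, \<rho>)" by (cases d)
  have le: "u \<bullet> z + \<rho> * f z \<le> u \<bullet> y + \<rho> * r" if "f y < r" for y r
    using d(2) d(3)[of "(y, r)"] that by (simp add: ur)
  have "\<rho> \<ge> 0" using le[of z "f z + 1"] by (simp add: algebra_simps)
  moreover have "\<rho> \<noteq> 0"
  proof
    assume "\<rho> = 0"
    then have "u \<bullet> u \<le> 0" using le[of "z - u" "f (z - u) + 1"] by (simp add: inner_diff_right)
    then have "u = 0" by (metis inner_eq_zero_iff inner_ge_zero order_antisym)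
    then show False using d(1) ur \<open>\<rho> = 0\<close> by (simp add: zero_prod_def)
  qed
  ultimately have \<rho>: "\<rho> > 0" by simp
  have "f z + ((- 1 / \<rho>) *\<^sub>R u) \<bullet> (y - z) \<le> f y" for y
  proof (rule dense_ge)
    fix r assume "f y < r"
    then have "u \<bullet> z + \<rho> * f z \<le> u \<bullet> y + \<rho> * r" by (rule le)
    then show "f z + ((- 1 / \<rho>) *\<^sub>R u) \<bullet> (y - z) \<le> r"
      using \<rho> by (simp add: inner_diff_right field_simps)
  qed
  then show ?thesis by blast
qed

lemma legendre_upper: "ereal (p \<bullet> y - \<Phi> y) \<le> legendre \<Phi> p"
  unfolding legendre_def by (rule SUP_upper) simp

text \<open>Replaces an extended-real inequality by a family of real ones, absorbing the case of an
  infinite transform.\<close>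

lemma le_minus_legendre_iff:
  "ereal c \<le> ereal h - legendre \<Phi> p \<longleftrightarrow> (\<forall>y. c \<le> h - p \<bullet> y + \<Phi> y)"
proof -
  have "ereal c \<le> ereal h - legendre \<Phi> p \<longleftrightarrow> legendre \<Phi> p \<le> ereal (h - c)"
    using legendre_upper[of p 0 \<Phi>] by (cases "legendre \<Phi> p") auto
  also have "\<dots> \<longleftrightarrow> (\<forall>y. c \<le> h - p \<bullet> y + \<Phi> y)"
    unfolding legendre_def by (auto simp: SUP_le_iff algebra_simps)
  finally show ?thesis .
qed

text \<open>\<open>Z p\<close> is a supergradient of the concave function \<open>H\<close> at \<open>p\<close>; the quadratic remainder
  \<open>\<kappa>\<close> makes \<open>Z\<close> Lipschitz, so that \<open>Z\<close> is in fact the gradient of \<open>H\<close>.\<close>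

locale supergradient_duality =
  fixes H :: "'a::euclidean_space \<Rightarrow> real" and Z :: "'a \<Rightarrow> 'a" and \<kappa> :: real and \<Phi> :: "'a \<Rightarrow> real"
  assumes \<kappa>: "0 < \<kappa>"
    and super: "\<And>p q. H q + \<kappa> * (norm (Z p - Z q))\<^sup>2 \<le> H p + (q - p) \<bullet> Z p"
    and convex: "convex_on UNIV \<Phi>"
begin

definition dual :: "'a \<Rightarrow> ereal" where "dual p = ereal (H p) - legendre \<Phi> p"

lemma super0: "H q \<le> H p + (q - p) \<bullet> Z p"
  using super[of q p] \<kappa> by (smt (verit) mult_nonneg_nonneg zero_le_power2)

text \<open>Adding the supergradient inequalities for \<open>(p, q)\<close> and
  \<open>(q, p)\<close> cancels \<open>H\<close> and doubles the remainder; Cauchy-Schwarz then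
  yields the constant \<open>1 / (2 * \<kappa>)\<close>.\<close>

lemma Z_Lipschitz: "norm (Z p - Z q) \<le> norm (p - q) / (2 * \<kappa>)"
proof (cases "Z p = Z q")
  case False
  have "2 * \<kappa> * (norm (Z p - Z q))\<^sup>2 \<le> (q - p) \<bullet> (Z p - Z q)"
    using super[of q p] super[of p q] by (simp add: norm_minus_commute inner_diff algebra_simps)
  also have "\<dots> \<le> norm (q - p) * norm (Z p - Z q)" by (rule norm_cauchy_schwarz)
  finally have "2 * \<kappa> * norm (Z p - Z q) \<le> norm (q - p)"
    using False by (simp add: power2_eq_square)
  then show ?thesis using \<kappa> by (simp add: field_simps norm_minus_commute)
qed (use \<kappa> in simp)

text \<open>\<open>H\<close> is the minimum of its affine majorants and minus the transform is an
  infimum of affine functions, so a superlevel set is an intersection of closed affine constraints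
  in \<open>p\<close>. Its closedness is immediate in this form.\<close>

lemma dual_superlevel: "ereal c \<le> dual p \<longleftrightarrow> (\<forall>y q. c \<le> H q + (p - q) \<bullet> Z q - p \<bullet> y + \<Phi> y)"
proof -
  have "(\<forall>q. c \<le> H q + (p - q) \<bullet> Z q - p \<bullet> y + \<Phi> y) \<longleftrightarrow> c \<le> H p - p \<bullet> y + \<Phi> y" for y
  proof safe
    assume "\<forall>q. c \<le> H q + (p - q) \<bullet> Z q - p \<bullet> y + \<Phi> y"
    from spec[OF this, of p] show "c \<le> H p - p \<bullet> y + \<Phi> y" by simp
  next
    fix q assume "c \<le> H p - p \<bullet> y + \<Phi> y"
    then show "c \<le> H q + (p - q) \<bullet> Z q - p \<bullet> y + \<Phi> y" using super0[of p q] by simp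
  qed
  then show ?thesis unfolding dual_def le_minus_legendre_iff by simp
qed

lemma closed_superlevel: "closed {p. ereal c \<le> dual p}"
  unfolding dual_superlevel by (intro closed_Collect_all closed_Collect_le continuous_intros)

text \<open>The majorant of \<open>H\<close> at 0 grows like \<open>p \<bullet> Z 0\<close>. Testing
  the transform at \<open>Z 0 + sgn p\<close> cancels this growth and leaves
  \<open>- norm p\<close>, while \<open>\<Phi>\<close> stays bounded on the unit ball around
  \<open>Z 0\<close>.\<close>

lemma superlevel_norm_bound:
  obtains B where "\<And>c p. ereal c \<le> dual p \<Longrightarrow> norm p \<le> B - c"
proof -
  have "continuous_on (cball (Z 0) 1) \<Phi>"
    using convex_on_continuous[OF open_UNIV convex] continuous_on_subset by blast
  then obtain w where w: "\<And>y. y \<in> cball (Z 0) 1 \<Longrightarrow> \<Phi> y \<le> \<Phi> w"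
    using continuous_attains_sup[of "cball (Z 0) 1" \<Phi>] by (auto simp del: mem_cball)
  show thesis
  proof (rule that[of "H 0 + \<Phi> w"])
    fix c p assume "ereal c \<le> dual p"
    then have "c \<le> H 0 + (p - 0) \<bullet> Z 0 - p \<bullet> (Z 0 + sgn p) + \<Phi> (Z 0 + sgn p)"
      unfolding dual_superlevel by blast
    moreover have "p \<bullet> sgn p = norm p"
      by (cases "p = 0") (simp_all add: sgn_div_norm dot_square_norm power2_eq_square)
    moreover have "\<Phi> (Z 0 + sgn p) \<le> \<Phi> w"
      by (rule w) (simp add: dist_norm norm_sgn)
    ultimately show "norm p \<le> H 0 + \<Phi> w - c" by (simp add: inner_add_right)
  qed
qed

text \<open>A subgradient at \<open>z\<close> bounds the transform by its value on the test point
  \<open>z\<close>. This yields points where the dual objective is finite.\<close>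

lemma dual_subgradient:
  assumes "\<And>y. \<Phi> z + q \<bullet> (y - z) \<le> \<Phi> y"
  shows "ereal (H q - (q \<bullet> z - \<Phi> z)) \<le> dual q"
  unfolding dual_def le_minus_legendre_iff using assms by (simp add: inner_diff_right algebra_simps)

text \<open>The objective may be minus infinity, so real levels are used: compact nested superlevel
  sets at levels tending to the supremum have a common point. A subgradient of \<open>\<Phi>\<close>
  at 0 shows that some level is reached.\<close>

lemma dual_max_exists: "\<exists>p. is_arg_max dual (\<lambda>_. True) p"
proof -
  obtain B where B: "\<And>c p. ereal c \<le> dual p \<Longrightarrow> norm p \<le> B - c" using superlevel_norm_bound by blast
  define C where "C = {c. \<exists>p. ereal c \<le> dual p}"
  obtain q where "\<And>y. \<Phi> 0 + q \<bullet> (y - 0) \<le> \<Phi> y" using convex_subgradient_exists[OF convex] by blast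
  then have C0: "C \<noteq> {}" using dual_subgradient[of 0 q] unfolding C_def by blast
  have "c \<le> B" if "c \<in> C" for c
    using that B[of c] norm_ge_zero unfolding C_def by (smt (verit) mem_Collect_eq)
  then have bdd: "bdd_above C" by (rule bdd_aboveI)
  define s where "s = Sup C"
  have "(\<Inter>n. {p. ereal (s - 1 / real (Suc n)) \<le> dual p}) \<noteq> {}"
  proof (rule compact_nest)
    fix n
    have "bounded {p. ereal (s - 1 / real (Suc n)) \<le> dual p}"
      using B by (auto simp: bounded_iff)
    then show "compact {p. ereal (s - 1 / real (Suc n)) \<le> dual p}"
      using closed_superlevel by (simp add: compact_eq_bounded_closed)
    obtain c where "c \<in> C" "s - 1 / real (Suc n) < c"
      using less_cSupD[OF C0, of "s - 1 / real (Suc n)"] unfolding s_def by auto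
    then show "{p. ereal (s - 1 / real (Suc n)) \<le> dual p} \<noteq> {}"
      unfolding C_def by (force intro: order_trans[of _ "ereal c"])
  next
    fix m n :: nat assume "m \<le> n"
    then have "1 / real (Suc n) \<le> 1 / real (Suc m)" by (simp add: frac_le)
    then have le: "ereal (s - 1 / real (Suc m)) \<le> ereal (s - 1 / real (Suc n))" by simp
    show "{p. ereal (s - 1 / real (Suc n)) \<le> dual p} \<subseteq> {p. ereal (s - 1 / real (Suc m)) \<le> dual p}"
      using order_trans[OF le] by blast
  qed
  then obtain p where p: "\<And>n. ereal (s - 1 / real (Suc n)) \<le> dual p" by blast
  have "\<not> dual p < dual q" for q
  proof
    assume "dual p < dual q"
    \<comment> \<open>Real numbers \<open>e < c\<close> between the two values give a contradiction:
      \<open>c \<le> s\<close> puts \<open>e\<close> below one of the levels that \<open>p\<close>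
      reaches.\<close>
    then obtain c where c: "dual p < ereal c" "ereal c < dual q" using ereal_dense2 by blast
    then have "c \<le> s" unfolding s_def C_def using bdd[unfolded C_def] by (intro cSup_upper) (auto intro: less_imp_le)
    moreover obtain e where e: "dual p < ereal e" "ereal e < ereal c" using c(1) ereal_dense2 by blast
    ultimately have "s - e > 0" by simp
    from reals_Archimedean[OF this] obtain n where "1 / real (Suc n) < s - e"
      by (auto simp: inverse_eq_divide)
    then have "ereal e \<le> ereal (s - 1 / real (Suc n))" by simp
    then have "ereal e \<le> dual p" using p[of n] by (rule order_trans)
    then show False using e(1) by simp
  qed
  then show ?thesis by (auto simp: is_arg_max_def)
qed

text \<open>First-order optimality: move from \<open>p\<close> towards a subgradient \<open>q\<close> of \<open>\<Phi>\<close> at \<open>Z p\<close>.\<close>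

lemma legendre_at_max:
  assumes "is_arg_max dual (\<lambda>_. True) p"
  shows "legendre \<Phi> p = ereal (p \<bullet> Z p - \<Phi> (Z p))"
proof -
  have max: "dual r \<le> dual p" for r using assms by (auto simp: is_arg_max_def not_less)
  obtain q where q: "\<And>y. \<Phi> (Z p) + q \<bullet> (y - Z p) \<le> \<Phi> y"
    using convex_subgradient_exists[OF convex] by blast
  define G where "G = q \<bullet> Z p - \<Phi> (Z p)"
  have G: "q \<bullet> y - \<Phi> y \<le> G" for y using q[of y] by (simp add: G_def inner_diff_right)
  have "ereal (H q - G) \<le> dual p"
    using dual_subgradient[OF q] max[of q] unfolding G_def by (rule order_trans)
  \<comment> \<open>Comparison with the finite bound at \<open>q\<close> excludes an infinite
    transform at \<open>p\<close>.\<close>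
  then obtain F where F: "legendre \<Phi> p = ereal F"
    using legendre_upper[of p 0 \<Phi>] unfolding dual_def by (cases "legendre \<Phi> p") auto
  have Fy: "p \<bullet> y - \<Phi> y \<le> F" for y using legendre_upper[of p y \<Phi>] F by simp
  have step: "(q - p) \<bullet> Z p \<le> G - F + l * ((norm (q - p))\<^sup>2 / (2 * \<kappa>))" if l: "0 < l" "l \<le> 1" for l
  proof -
    define pl where "pl = p + l *\<^sub>R (q - p)"
    have "H pl - ((1 - l) * F + l * G) \<le> H pl - pl \<bullet> y + \<Phi> y" for y
    proof -
      have "pl \<bullet> y - \<Phi> y = (1 - l) * (p \<bullet> y - \<Phi> y) + l * (q \<bullet> y - \<Phi> y)"
        by (simp add: pl_def inner_simps algebra_simps)
      also have "\<dots> \<le> (1 - l) * F + l * G"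
        using l by (intro add_mono mult_left_mono Fy G) auto
      finally show ?thesis by simp
    qed
    then have "ereal (H pl - ((1 - l) * F + l * G)) \<le> dual pl"
      unfolding dual_def le_minus_legendre_iff by blast
    also have "\<dots> \<le> dual p" by (rule max)
    finally have "H pl - ((1 - l) * F + l * G) \<le> H p - F" by (simp add: dual_def F)
    \<comment> \<open>The supergradient is taken at \<open>pl\<close>, because the one at
      \<open>p\<close> bounds \<open>H pl\<close> only from above. Lipschitz continuity of
      \<open>Z\<close> then returns to \<open>p\<close> with an error of order
      \<open>l\<close>.\<close>
    moreover have "H p \<le> H pl - l * ((q - p) \<bullet> Z pl)" using super0[of p pl] by (simp add: pl_def)
    ultimately have "l * ((q - p) \<bullet> Z pl) \<le> l * (G - F)" by (simp add: algebra_simps)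
    then have 1: "(q - p) \<bullet> Z pl \<le> G - F" using l by simp
    have "(q - p) \<bullet> (Z p - Z pl) \<le> norm (q - p) * norm (Z p - Z pl)" by (rule norm_cauchy_schwarz)
    also have "\<dots> \<le> norm (q - p) * (norm (p - pl) / (2 * \<kappa>))"
      by (intro mult_left_mono Z_Lipschitz) simp
    also have "\<dots> = l * ((norm (q - p))\<^sup>2 / (2 * \<kappa>))"
      using l by (simp add: pl_def power2_eq_square)
    finally show ?thesis using 1 by (simp add: inner_diff_right)
  qed
  have "((\<lambda>l. G - F + l * ((norm (q - p))\<^sup>2 / (2 * \<kappa>))) \<longlongrightarrow> G - F + 0 * ((norm (q - p))\<^sup>2 / (2 * \<kappa>))) (at_right 0)"
    by (intro tendsto_intros)
  moreover have "eventually (\<lambda>l. (q - p) \<bullet> Z p \<le> G - F + l * ((norm (q - p))\<^sup>2 / (2 * \<kappa>))) (at_right 0)"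
    using step by (auto simp: eventually_at_right_field intro!: exI[of _ 1])
  ultimately have "(q - p) \<bullet> Z p \<le> G - F + 0 * ((norm (q - p))\<^sup>2 / (2 * \<kappa>))"
    by (rule tendsto_lowerbound) simp
  then have "F \<le> p \<bullet> Z p - \<Phi> (Z p)" by (simp add: G_def inner_diff_left)
  then show ?thesis using Fy[of "Z p"] F by simp
qed

end

section \<open>The vector problem\<close>

lemma lipschitz_on_component:
  fixes y :: "real \<Rightarrow> real^'n"
  assumes "L-lipschitz_on S y"
  shows "L-lipschitz_on S (\<lambda>s. y s $ i)"
proof (rule lipschitz_onI)
  fix r s assume "r \<in> S" "s \<in> S"
  then show "dist (y r $ i) (y s $ i) \<le> L * dist r s"
    using order_trans[OF dist_vec_nth_le lipschitz_onD[OF assms]] by blast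
qed (rule lipschitz_on_nonneg[OF assms])

text \<open>Off the finite union of the null sets of the components all components are
  differentiable at once, so the vector derivative exists there and has the expected
  components.\<close>

lemma admissible_derivative_AE:
  fixes y :: "real \<Rightarrow> real^'n"
  assumes adm: "admissible x t y" and t: "0 < t"
  shows "\<exists>N. negligible N \<and> (\<forall>s\<in>{0..t} - N. \<forall>i.
     ((\<lambda>s. y s $ i) has_real_derivative vector_derivative y (at s within {0..t}) $ i) (at s within {0..t}))"
proof -
  obtain L where L: "L-lipschitz_on {0..t} y" using adm by (auto simp: admissible_def)
  have "\<forall>i. \<exists>N. negligible N \<and> (\<forall>s\<in>{0..t} - N. (\<lambda>s. y s $ i) differentiable (at s within {0..t}))"
    using Lipschitz_differentiable_AE[OF lipschitz_on_component[OF L]] t by (simp add: less_imp_le)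
  then obtain N where N: "\<And>i. negligible (N i)"
    "\<And>i s. s \<in> {0..t} - N i \<Longrightarrow> (\<lambda>s. y s $ i) differentiable (at s within {0..t})"
    by metis
  have "((\<lambda>s. y s $ i) has_real_derivative vector_derivative y (at s within {0..t}) $ i) (at s within {0..t})"
    if s: "s \<in> {0..t} - (\<Union>i. N i)" for s i
  proof -
    have "\<forall>i. \<exists>d. ((\<lambda>s. y s $ i) has_real_derivative d) (at s within {0..t})"
      using N(2)[of s] s by (auto simp: real_differentiable_def)
    then obtain d where d: "\<And>i. ((\<lambda>s. y s $ i) has_real_derivative d i) (at s within {0..t})"
      by metis
    have "(y has_vector_derivative (\<chi> i. d i)) (at s within {0..t})"
      unfolding has_vector_derivative_def
    proof (subst has_derivative_componentwise_within, intro ballI)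
      fix e :: "real^'n" assume "e \<in> Basis"
      then obtain i where e: "e = axis i 1" by (auto simp: Basis_vec_def)
      show "((\<lambda>s. y s \<bullet> e) has_derivative (\<lambda>h. (h *\<^sub>R (\<chi> i. d i)) \<bullet> e)) (at s within {0..t})"
        using has_derivative_eq_rhs[OF d[of i, unfolded has_field_derivative_def], of "\<lambda>h. h * d i"]
        by (simp add: e inner_axis fun_eq_iff mult.commute)
    qed
    then have "vector_derivative y (at s within {0..t}) = (\<chi> i. d i)"
      using s t by (intro vector_derivative_within_closed_interval) auto
    then show ?thesis using d by simp
  qed
  moreover have "negligible (\<Union>i. N i)" using N(1) by (intro negligible_Union) auto
  ultimately show ?thesis by blast
qed

lemma norm_square_vec: "(norm v)\<^sup>2 = (\<Sum>i\<in>UNIV. (v $ i)\<^sup>2)" for v :: "real^'n"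
  unfolding power2_norm_eq_inner inner_vec_def by (simp add: power2_eq_square)

locale piecewise_linear_control =
  fixes \<Phi> :: "real^'n \<Rightarrow> real" and a b x :: "real^'n" and t :: real
  assumes convex_cost: "convex_on UNIV \<Phi>" and a: "\<And>i. 0 < a $ i" and b: "\<And>i. 0 < b $ i" and t: "0 < t"
begin

abbreviation "H p \<equiv> (\<Sum>i\<in>UNIV. V_expl (x$i) t (p$i) (a$i) (b$i))"

abbreviation "\<Gamma> p \<equiv> gamma_vec a b x t p"

lemma extremal: "extremal (a$i) (b$i) t (p$i) (x$i) (V_expl (x$i) t (p$i) (a$i) (b$i)) (\<lambda>s. \<Gamma> p s $ i)"
  using extremal_expl[OF a b t] by (simp add: gamma_vec_def)

lemma admissible_Gamma: "admissible x t (\<Gamma> p)"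
proof -
  obtain L where L: "\<And>i. (L i)-lipschitz_on {0..t} (\<lambda>s. \<Gamma> p s $ i)"
    using extremal_Lipschitz[OF extremal] by metis
  have "(\<Sum>i\<in>UNIV. L i)-lipschitz_on {0..t} (\<Gamma> p)"
  proof (rule lipschitz_onI)
    fix r s assume rs: "r \<in> {0..t}" "s \<in> {0..t}"
    have "dist (\<Gamma> p r) (\<Gamma> p s) \<le> (\<Sum>i\<in>UNIV. \<bar>(\<Gamma> p r - \<Gamma> p s) $ i\<bar>)"
      unfolding dist_norm by (rule norm_le_l1_cart)
    also have "\<dots> \<le> (\<Sum>i\<in>UNIV. L i * dist r s)"
      using lipschitz_onD[OF L rs] by (intro sum_mono) (simp add: dist_real_def)
    finally show "dist (\<Gamma> p r) (\<Gamma> p s) \<le> (\<Sum>i\<in>UNIV. L i) * dist r s"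
      by (simp add: sum_distrib_right)
  qed (use lipschitz_on_nonneg[OF L] in \<open>auto intro: sum_nonneg\<close>)
  moreover have "\<Gamma> p t $ i = x $ i" for i
    using extremal[of i p] unfolding extremal_def by blast
  ultimately show ?thesis unfolding admissible_def by (auto simp: vec_eq_iff)
qed

lemma cost_componentwise:
  assumes adm: "admissible x t y"
  shows "\<exists>v N L. negligible N \<and> (\<forall>i. L-lipschitz_on {0..t} (\<lambda>s. y s $ i)) \<and>
    (\<forall>i. \<forall>s\<in>{0..t} - N. ((\<lambda>s. y s $ i) has_real_derivative v s $ i) (at s within {0..t})) \<and>
    cost \<Phi> a b t y = (\<Sum>i\<in>UNIV. cost1 (a$i) (b$i) t (\<lambda>s. v s $ i) (\<lambda>s. y s $ i)) + \<Phi> (y 0)"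
proof -
  let ?v = "\<lambda>s. vector_derivative y (at s within {0..t})"
  obtain N where N: "negligible N"
    "\<And>i s. s \<in> {0..t} - N \<Longrightarrow> ((\<lambda>s. y s $ i) has_real_derivative ?v s $ i) (at s within {0..t})"
    using admissible_derivative_AE[OF adm t] by blast
  obtain L where "L-lipschitz_on {0..t} y" using adm by (auto simp: admissible_def)
  note L = lipschitz_on_component[OF this]
  have "integral {0..t} (\<lambda>s. 1 / 2 * (norm (?v s))\<^sup>2 - potential a b (y s))
      = integral {0..t} (\<lambda>s. \<Sum>i\<in>UNIV. 1 / 2 * (?v s $ i)\<^sup>2 - potential1 (a$i) (b$i) (y s $ i))"
    by (simp add: norm_square_vec potential_def sum_subtractf sum_distrib_left)
  also have "\<dots> = (\<Sum>i\<in>UNIV. cost1 (a$i) (b$i) t (\<lambda>s. ?v s $ i) (\<lambda>s. y s $ i))"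
    unfolding cost1_def by (intro integral_sum cost1_integrable[OF L t N]) auto
  finally have "cost \<Phi> a b t y = (\<Sum>i\<in>UNIV. cost1 (a$i) (b$i) t (\<lambda>s. ?v s $ i) (\<lambda>s. y s $ i)) + \<Phi> (y 0)"
    by (simp add: cost_def)
  with N L show ?thesis by (intro exI[of _ ?v] exI[of _ N] exI[of _ L]) simp
qed

text \<open>Valid for every \<open>p\<close>, not just a maximizer. With another extremal as
  \<open>y\<close> it is the supergradient inequality of the dual problem; at a maximizer it gives
  optimality and uniqueness.\<close>

lemma cost_lower:
  assumes adm: "admissible x t y" and r: "r \<in> {0..t}"
  shows "H p + (norm (y r - \<Gamma> p r))\<^sup>2 / (2 * t) \<le> cost \<Phi> a b t y - \<Phi> (y 0) + p \<bullet> y 0"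
proof -
  obtain v N L where N: "negligible N" and L: "\<forall>i. L-lipschitz_on {0..t} (\<lambda>s. y s $ i)"
    and v: "\<forall>i. \<forall>s\<in>{0..t} - N. ((\<lambda>s. y s $ i) has_real_derivative v s $ i) (at s within {0..t})"
    and c: "cost \<Phi> a b t y = (\<Sum>i\<in>UNIV. cost1 (a$i) (b$i) t (\<lambda>s. v s $ i) (\<lambda>s. y s $ i)) + \<Phi> (y 0)"
    using cost_componentwise[OF adm] by (elim exE conjE) (rule that)
  have yt: "y t $ i = x $ i" for i using adm by (simp add: admissible_def)
  have "V_expl (x$i) t (p$i) (a$i) (b$i) + (y r $ i - \<Gamma> p r $ i)\<^sup>2 / (2 * t)
      \<le> cost1 (a$i) (b$i) t (\<lambda>s. v s $ i) (\<lambda>s. y s $ i) + p$i * y 0 $ i" for i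
    by (rule extremal_verification(1)[OF extremal t L[rule_format] N v[rule_format] yt r])
  then have "(\<Sum>i\<in>UNIV. V_expl (x$i) t (p$i) (a$i) (b$i) + (y r $ i - \<Gamma> p r $ i)\<^sup>2 / (2 * t))
      \<le> (\<Sum>i\<in>UNIV. cost1 (a$i) (b$i) t (\<lambda>s. v s $ i) (\<lambda>s. y s $ i) + p$i * y 0 $ i)"
    by (rule sum_mono)
  then show ?thesis
    by (simp only: c norm_square_vec inner_vec_def sum_divide_distrib sum.distrib
        vector_minus_component inner_real_def add_diff_cancel_right')
qed

lemma cost_Gamma: "cost \<Phi> a b t (\<Gamma> p) = H p - p \<bullet> \<Gamma> p 0 + \<Phi> (\<Gamma> p 0)"
proof -
  obtain v N L where N: "negligible N" and L: "\<forall>i. L-lipschitz_on {0..t} (\<lambda>s. \<Gamma> p s $ i)"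
    and v: "\<forall>i. \<forall>s\<in>{0..t} - N. ((\<lambda>s. \<Gamma> p s $ i) has_real_derivative v s $ i) (at s within {0..t})"
    and c: "cost \<Phi> a b t (\<Gamma> p) = (\<Sum>i\<in>UNIV. cost1 (a$i) (b$i) t (\<lambda>s. v s $ i) (\<lambda>s. \<Gamma> p s $ i)) + \<Phi> (\<Gamma> p 0)"
    using cost_componentwise[OF admissible_Gamma[of p]] by (elim exE conjE) (rule that)
  have yt: "\<Gamma> p t $ i = x $ i" for i using admissible_Gamma[of p] by (simp add: admissible_def)
  have "cost1 (a$i) (b$i) t (\<lambda>s. v s $ i) (\<lambda>s. \<Gamma> p s $ i) + p$i * \<Gamma> p 0 $ i
      = V_expl (x$i) t (p$i) (a$i) (b$i)" for i
    by (rule extremal_verification(2)[OF extremal t L[rule_format] N v[rule_format] yt refl])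
  then have "(\<Sum>i\<in>UNIV. cost1 (a$i) (b$i) t (\<lambda>s. v s $ i) (\<lambda>s. \<Gamma> p s $ i) + p$i * \<Gamma> p 0 $ i) = H p"
    by simp
  then show ?thesis unfolding c inner_vec_def sum.distrib inner_real_def by linarith
qed

text \<open>The extremal for \<open>p\<close> competes in the problem for \<open>q\<close>, and the
  excess is read at time 0; hence the remainder constant \<open>1 / (2 * t)\<close>.\<close>

sublocale supergradient_duality H "\<lambda>p. \<Gamma> p 0" "1 / (2 * t)" \<Phi>
proof
  fix p q
  have "H q + (norm (\<Gamma> p 0 - \<Gamma> q 0))\<^sup>2 / (2 * t) \<le> H p - p \<bullet> \<Gamma> p 0 + q \<bullet> \<Gamma> p 0"
    using cost_lower[OF admissible_Gamma, of 0 q p] t by (simp add: cost_Gamma)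
  then show "H q + 1 / (2 * t) * (norm (\<Gamma> p 0 - \<Gamma> q 0))\<^sup>2 \<le> H p + (q - p) \<bullet> \<Gamma> p 0"
    by (simp add: inner_diff_left)
qed (use t convex_cost in auto)

lemma dual_eq: "dual = hopf_objective \<Phi> a b x t"
  by (simp add: fun_eq_iff dual_def hopf_objective_def)

text \<open>The initial velocity in component \<open>i\<close> is the \<open>i\<close>-th entry of
  the parameter. Uniqueness of the optimal trajectory thus transfers to the maximizer.\<close>

lemma Gamma_inject:
  assumes "\<And>s. s \<in> {0..t} \<Longrightarrow> \<Gamma> p s = \<Gamma> q s"
  shows "p = q"
proof -
  have "p $ i = q $ i" for i
  proof -
    have "((\<lambda>s. \<Gamma> p s $ i) has_real_derivative q $ i) (at 0 within {0..t})"
      by (rule has_field_derivative_transform_within[OF extremal_initial_derivative[OF extremal t], of 1])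
        (use assms t in auto)
    moreover have "at 0 within {0..t} \<noteq> bot"
      using t by (simp add: trivial_limit_within islimpt_Icc)
    ultimately show ?thesis
      using extremal_initial_derivative[OF extremal[of i p] t] has_field_derivative_unique by blast
  qed
  then show ?thesis by (simp add: vec_eq_iff)
qed

section \<open>Consequences at a maximizer of the dual problem\<close>

context
  fixes p
  assumes max: "is_arg_max (hopf_objective \<Phi> a b x t) (\<lambda>_. True) p"
begin

text \<open>No duality gap: equality in Fenchel-Young at \<open>\<Gamma> p 0\<close> replaces the
  transform by exactly the terms in which \<open>cost_Gamma\<close> differs from
  \<open>H p\<close>.\<close>

lemma dual_value: "hopf_objective \<Phi> a b x t p = ereal (cost \<Phi> a b t (\<Gamma> p))"
  using legendre_at_max[of p] max by (simp add: dual_eq[symmetric] dual_def cost_Gamma)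

lemma cost_optimal:
  assumes "admissible x t y" "r \<in> {0..t}"
  shows "cost \<Phi> a b t (\<Gamma> p) + (norm (y r - \<Gamma> p r))\<^sup>2 / (2 * t) \<le> cost \<Phi> a b t y"
proof -
  have "p \<bullet> y 0 - \<Phi> (y 0) \<le> p \<bullet> \<Gamma> p 0 - \<Phi> (\<Gamma> p 0)"
    using legendre_upper[of p "y 0" \<Phi>] legendre_at_max[of p] max by (simp add: dual_eq)
  then show ?thesis using cost_lower[OF assms, of p] cost_Gamma[of p] by simp
qed

lemma optimal_value_eq: "optimal_value \<Phi> a b x t = ereal (cost \<Phi> a b t (\<Gamma> p))"
  unfolding optimal_value_def
proof (rule antisym)
  show "(INF y\<in>{y. admissible x t y}. ereal (cost \<Phi> a b t y)) \<le> ereal (cost \<Phi> a b t (\<Gamma> p))"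
    by (rule INF_lower) (simp add: admissible_Gamma)
  show "ereal (cost \<Phi> a b t (\<Gamma> p)) \<le> (INF y\<in>{y. admissible x t y}. ereal (cost \<Phi> a b t y))"
  proof (rule INF_greatest)
    fix y assume "y \<in> {y. admissible x t y}"
    then have "cost \<Phi> a b t (\<Gamma> p) + (norm (y 0 - \<Gamma> p 0))\<^sup>2 / (2 * t) \<le> cost \<Phi> a b t y"
      using t by (intro cost_optimal) auto
    moreover have "0 \<le> (norm (y 0 - \<Gamma> p 0))\<^sup>2 / (2 * t)" using t by simp
    ultimately show "ereal (cost \<Phi> a b t (\<Gamma> p)) \<le> ereal (cost \<Phi> a b t y)" by simp
  qed
qed

lemma optimal_Gamma: "optimal_trajectory \<Phi> a b x t (\<Gamma> p)"
  by (simp add: optimal_trajectory_def admissible_Gamma optimal_value_eq)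

lemma optimal_unique:
  assumes "optimal_trajectory \<Phi> a b x t y" "s \<in> {0..t}"
  shows "y s = \<Gamma> p s"
proof -
  have "admissible x t y" "cost \<Phi> a b t y = cost \<Phi> a b t (\<Gamma> p)"
    using assms(1) by (auto simp: optimal_trajectory_def optimal_value_eq)
  then have "(norm (y s - \<Gamma> p s))\<^sup>2 / (2 * t) \<le> 0" using cost_optimal[OF _ assms(2), of y] by simp
  then have "(norm (y s - \<Gamma> p s))\<^sup>2 \<le> 0" using t by (simp add: divide_le_0_iff)
  then show ?thesis by simp
qed

lemma V_hopf_eq: "V_hopf \<Phi> a b x t = ereal (cost \<Phi> a b t (\<Gamma> p))"
  unfolding V_hopf_def dual_value[symmetric]
proof (rule antisym)
  show "(SUP q. hopf_objective \<Phi> a b x t q) \<le> hopf_objective \<Phi> a b x t p"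
    using max by (intro SUP_least) (auto simp: is_arg_max_def not_less)
qed (rule SUP_upper, simp)

end

end

theorem proposition2p4:
  fixes \<Phi> :: "real^'n \<Rightarrow> real"
    and C \<delta> t :: real
    and a b x :: "real^'n"
  assumes "convex_on UNIV \<Phi>"
    and "C \<ge> 0" and "\<delta> \<ge> 0"
    and "\<forall>u v. \<bar>\<Phi> u - \<Phi> v\<bar> \<le> C * norm (u - v) * (1 + norm u powr \<delta> + norm v powr \<delta>)"
    and "\<forall>i. a$i > 0" and "\<forall>i. b$i > 0"
    and "t > 0"
  shows "(\<exists>!p. is_arg_max (hopf_objective \<Phi> a b x t) (\<lambda>_. True) p) \<and>
         (\<forall>p. is_arg_max (hopf_objective \<Phi> a b x t) (\<lambda>_. True) p \<longrightarrow>
            optimal_trajectory \<Phi> a b x t (gamma_vec a b x t p) \<and>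
            (\<forall>y. optimal_trajectory \<Phi> a b x t y \<longrightarrow>
                 (\<forall>s\<in>{0..t}. y s = gamma_vec a b x t p s))) \<and>
         optimal_value \<Phi> a b x t = V_hopf \<Phi> a b x t"
proof -
  interpret piecewise_linear_control \<Phi> a b x t
    using assms by unfold_locales auto
  obtain p where p: "is_arg_max (hopf_objective \<Phi> a b x t) (\<lambda>_. True) p"
    using dual_max_exists unfolding dual_eq by blast
  have "q = p" if "is_arg_max (hopf_objective \<Phi> a b x t) (\<lambda>_. True) q" for q
    by (rule Gamma_inject) (rule optimal_unique[OF p optimal_Gamma[OF that]])
  with p have "\<exists>!p. is_arg_max (hopf_objective \<Phi> a b x t) (\<lambda>_. True) p" by blast
  then show ?thesis
    using optimal_Gamma optimal_unique optimal_value_eq[OF p] V_hopf_eq[OF p] by simp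
qed

end
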